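(* Let $b,p$ satisfy the standing assumptions in the context. Let $\lambda\in[0,\lambda^* )^S$ be a solution of $\sum_x\lambda_xp(x,y)=\lambda_y\sum_xp(y,x)$ for all $y\in S$. Then: (a) If $b(n,k)=b(n,0)$ for all $n,k\in W$, then $\mu_\lambda\in\mathcal I(L^{b,p})$. (b) If $b(n,k)-b(k,n)=b(n,0)-b(k,0)$ for all $n,k\in W$, and $\lambda$ is such that $\lambda_xp(x,y)\neq\lambda_yp(y,x)$ implies $\lambda_x=\lambda_y$, then $\mu_\lambda\in\mathcal I(L^{b,p})$. (c) If $\lambda_xp(x,y)=\lambda_yp(y,x)$ for all $x,y\in S$, then $\mu_\lambda\in\mathcal I(L^{b,p})$. Furthermore, any invariant measure $\mu_\lambda\in\mathcal P_\otimes(b)\cap\mathcal I(L^{b,p})$ must be of one of these three types, i.e. $\lambda$ is a solution of $\sum_x\lambda_xp(x,y)=\lambda_y\sum_xp(y,x)$ for all $y$, and the pair $(\lambda,b)$ satisfies the hypotheses of (a), (b) or (c).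
   Context: $S$ is a countably infinite set; $W=\{0,\dots,N\}$ or $W=\mathbb N=\{0,1,2,\dots\}$; $E=W^S$ with product topology ($W$ discrete) and product $\sigma$-algebra. $\eta^{x,y}=\eta-\delta_x+\delta_y$. For $f:E\to\mathbb R$, $\Delta_f(i)=\sup\{|f(\eta)-f(\zeta)|:\eta_j=\zeta_j\ \forall j\ne i\}$ and $D=\{f\in C_b(E):\sum_x\Delta_f(x)<\infty\}$, with uniform closure $\overline D$. For $p:S\times S\to[0,\infty)$ and bounded $b:W\times W\to[0,\infty)$, $f\in D$, $$L^{b,p}f(\eta)=\sum_{x,y}p(x,y)\,b(\eta_x,\eta_y)\,(f(\eta^{x,y})-f(\eta)),$$ where terms with $b(\eta_x,\eta_y)=0$ are read as $0$. Standing assumptions: (1) $p$ is finite range (for each $x$ only finitely many $y$ have $p(x,y)+p(y,x)>0$) and $\sup_x\sum_y(p(x,y)+p(y,x))<\infty$. (2) $p$ is irreducible and $b$ is strictly positive except that $b(0,\cdot)=0$ and, if $W=\{0,\dots,N\}$, $b(\cdot,N)=0$. (3) For all $i,j\in W$ for which the expressions make sense ($j\ge1$, $i+1\in W$), $\dfrac{b(i+1,j-1)}{b(j,i)}=\dfrac{b(1,j-1)}{b(j,0)}\dfrac{b(i+1,0)}{b(1,i)}$. (4) If $W=\mathbb N$, $\inf_i\frac{b(i+1,0)}{b(1,i)}>0$. Then $L^{b,p}$ generates a Markov semigroup on $\overline D$ with core $D$. $\mathcal I(L^{b,p})$ is the set of stationary probability measures, equivalently $\{\mu:\int L^{b,p}f\,d\mu=0\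 \forall f\in D\}$. Product measures: $a_0=1$, $a_k=\prod_{i=0}^{k-1}\frac{b(1,i)}{b(i+1,0)}$ for $k\in W$, $Z_\lambda=\sum_{k\in W}a_k\lambda^k$; $\lambda^*=\liminf_j\frac{b(j+1,0)}{b(1,j)}$ if $W=\mathbb N$ and $\lambda^*=\infty$ if $W=\{0,\dots,N\}$. For $\lambda\in[0,\lambda^* )^S$, $\mu_\lambda=\bigotimes_{x\in S}\mu_{\lambda_x}$ with $\mu_{\lambda_x}(n)=Z_{\lambda_x}^{-1}a_n\lambda_x^n$, $n\in W$. $\mathcal P_\otimes(b)=\{\mu_\lambda:\lambda\in[0,\lambda^* )^S\}$. *)

theory Defs
  imports "HOL-Probability.Probability"
begin

section \<open>Configurations\<close>

text \<open>
  The set of sites \<open>S\<close> is the universe of a countable type \<open>'s\<close>, whose infiniteness is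
  assumed separately. The parameter \<open>N :: enat\<close> covers both choices of \<open>W\<close>: the set \<open>W\<close> is
  \<open>{0..N}\<close> if \<open>N\<close> is finite and the set of all natural numbers if \<open>N = \<infinity>\<close>.
  A configuration is a function \<open>'s \<Rightarrow> nat\<close> with values in \<open>W\<close>. Functions on \<open>E\<close> are represented
  by functions on all of \<open>'s \<Rightarrow> nat\<close>, whose values outside \<open>E\<close> never matter.
\<close>

definition occ :: "enat \<Rightarrow> nat set" where
  "occ N = {n. enat n \<le> N}"

definition config :: "enat \<Rightarrow> ('s \<Rightarrow> nat) set" where
  "config N = {\<eta>. \<forall>x. \<eta> x \<in> occ N}"

definition config_algebra :: "enat \<Rightarrow> ('s \<Rightarrow> nat) measure" where
  "config_algebra N = PiM UNIV (\<lambda>_. count_space (occ N))"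

text \<open>
  The subtraction of naturals truncates if \<open>\<eta> x = 0\<close>, but then \<open>b (\<eta> x) (\<eta> y) = 0\<close>, and the
  generator below does not evaluate the jump. For \<open>x = y\<close> and \<open>\<eta> x > 0\<close> the result is \<open>\<eta>\<close>.
\<close>

definition jump :: "('s \<Rightarrow> nat) \<Rightarrow> 's \<Rightarrow> 's \<Rightarrow> 's \<Rightarrow> nat" where
  "jump \<eta> x y = (\<lambda>z. \<eta> z - (if z = x then 1 else 0) + (if z = y then 1 else 0))"


section \<open>The generator\<close>

definition variation :: "enat \<Rightarrow> (('s \<Rightarrow> nat) \<Rightarrow> real) \<Rightarrow> 's \<Rightarrow> real" where
  "variation N f i =
     Sup {\<bar>f \<eta> - f \<zeta>\<bar> |\<eta> \<zeta>. \<eta> \<in> config N \<and> \<zeta> \<in> config N \<and> (\<forall>j. j \<noteq> i \<longrightarrow> \<eta> j = \<zeta> j)}"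

text \<open>
  Continuity refers to the product topology on \<open>'s \<Rightarrow> nat\<close> with discrete factors. Its trace on
  \<open>E\<close> is the product topology of \<open>E\<close>. As \<open>f\<close> is bounded, the real suprema in \<^const>\<open>variation\<close>
  are meaningful.
\<close>

definition test_functions :: "enat \<Rightarrow> (('s \<Rightarrow> nat) \<Rightarrow> real) set" where
  "test_functions N =
     {f. continuous_on (config N) f \<and> bounded (f ` config N) \<and> variation N f summable_on UNIV}"

definition test_closure :: "enat \<Rightarrow> (('s \<Rightarrow> nat) \<Rightarrow> real) set" where
  "test_closure N =
     {f. \<forall>e>0. \<exists>g\<in>test_functions N. \<forall>\<eta>\<in>config N. \<bar>f \<eta> - g \<eta>\<bar> < e}"

definition generator ::
    "(nat \<Rightarrow> nat \<Rightarrow> real) \<Rightarrow> ('s \<Rightarrow> 's \<Rightarrow> real) \<Rightarrow> (('s \<Rightarrow> nat) \<Rightarrow> real) \<Rightarrow> ('s \<Rightarrow> nat) \<Rightarrow> real" where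
  "generator b p f \<eta> =
     (\<Sum>\<^sub>\<infinity>(x, y)\<in>UNIV.
        if b (\<eta> x) (\<eta> y) = 0 then 0
        else p x y * b (\<eta> x) (\<eta> y) * (f (jump \<eta> x y) - f \<eta>))"


section \<open>Standing assumptions\<close>

definition irreducible_kernel :: "('s \<Rightarrow> 's \<Rightarrow> real) \<Rightarrow> bool" where
  "irreducible_kernel p \<longleftrightarrow> (\<forall>x y. (x, y) \<in> {(u, v). p u v > 0}\<^sup>*)"

text \<open>
  The requirement \<open>1 \<le> N\<close> is implicit in the expressions \<open>b (1, i)\<close> and \<open>b (i + 1, 0)\<close>.
\<close>

definition standing_assumptions ::
    "enat \<Rightarrow> (nat \<Rightarrow> nat \<Rightarrow> real) \<Rightarrow> ('s \<Rightarrow> 's \<Rightarrow> real) \<Rightarrow> bool" where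
  "standing_assumptions N b p \<longleftrightarrow>
     1 \<le> N \<and>
     (\<forall>x y. 0 \<le> p x y) \<and>
     (\<forall>n\<in>occ N. \<forall>k\<in>occ N. 0 \<le> b n k) \<and>
     (\<exists>B. \<forall>n\<in>occ N. \<forall>k\<in>occ N. b n k \<le> B) \<and>
     \<comment> \<open>finite range, uniformly bounded total rates\<close>
     (\<forall>x. finite {y. p x y + p y x > 0}) \<and>
     bdd_above (range (\<lambda>x. \<Sum>\<^sub>\<infinity>y. p x y + p y x)) \<and>
     \<comment> \<open>irreducibility, positivity\<close>
     irreducible_kernel p \<and>
     (\<forall>n\<in>occ N. \<forall>k\<in>occ N. b n k = 0 \<longleftrightarrow> n = 0 \<or> enat k = N) \<and>
     \<comment> \<open>algebraic relation for \<open>b\<close>\<close>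
     (\<forall>i j. i + 1 \<in> occ N \<longrightarrow> j \<in> occ N \<longrightarrow> 1 \<le> j \<longrightarrow>
        b (i + 1) (j - 1) / b j i = (b 1 (j - 1) / b j 0) * (b (i + 1) 0 / b 1 i)) \<and>
     (N = \<infinity> \<longrightarrow> 0 < (INF i. b (i + 1) 0 / b 1 i))"


section \<open>Invariant measures\<close>

text \<open>
  The invariant measures are given by the generator criterion. The theorem
  \<open>stationary_measures_eq_invariant_measures\<close> at the end of this theory shows that they are
  exactly the stationary measures of the Markov semigroup generated by \<open>generator b p\<close> with core
  \<open>test_functions N\<close>.
\<close>

definition invariant_measures ::
    "enat \<Rightarrow> (nat \<Rightarrow> nat \<Rightarrow> real) \<Rightarrow> ('s \<Rightarrow> 's \<Rightarrow> real) \<Rightarrow> ('s \<Rightarrow> nat) measure set" where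
  "invariant_measures N b p =
     {\<mu>. prob_space \<mu> \<and> sets \<mu> = sets (config_algebra N) \<and>
         (\<forall>f\<in>test_functions N. integral\<^sup>L \<mu> (generator b p f) = 0)}"


section \<open>Product measures\<close>

definition weight :: "(nat \<Rightarrow> nat \<Rightarrow> real) \<Rightarrow> nat \<Rightarrow> real" where
  "weight b k = (\<Prod>i<k. b 1 i / b (i + 1) 0)"

definition partition_function :: "enat \<Rightarrow> (nat \<Rightarrow> nat \<Rightarrow> real) \<Rightarrow> real \<Rightarrow> real" where
  "partition_function N b l = (\<Sum>\<^sub>\<infinity>k\<in>occ N. weight b k * l ^ k)"

definition critical_value :: "enat \<Rightarrow> (nat \<Rightarrow> nat \<Rightarrow> real) \<Rightarrow> ereal" where
  "critical_value N b =
     (if N = \<infinity> then liminf (\<lambda>j. ereal (b (j + 1) 0 / b 1 j)) else \<infinity>)"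

definition parameters :: "enat \<Rightarrow> (nat \<Rightarrow> nat \<Rightarrow> real) \<Rightarrow> ('s \<Rightarrow> real) set" where
  "parameters N b = {l. \<forall>x. 0 \<le> l x \<and> ereal (l x) < critical_value N b}"

definition marginal :: "enat \<Rightarrow> (nat \<Rightarrow> nat \<Rightarrow> real) \<Rightarrow> real \<Rightarrow> nat measure" where
  "marginal N b l =
     point_measure (occ N) (\<lambda>n. ennreal (weight b n * l ^ n / partition_function N b l))"

definition product_measure ::
    "enat \<Rightarrow> (nat \<Rightarrow> nat \<Rightarrow> real) \<Rightarrow> ('s \<Rightarrow> real) \<Rightarrow> ('s \<Rightarrow> nat) measure" where
  "product_measure N b l = PiM UNIV (\<lambda>x. marginal N b (l x))"

definition product_measures ::
    "enat \<Rightarrow> (nat \<Rightarrow> nat \<Rightarrow> real) \<Rightarrow> ('s \<Rightarrow> nat) measure set" where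
  "product_measures N b = product_measure N b ` parameters N b"


section \<open>The three types\<close>

definition balance_equation :: "('s \<Rightarrow> 's \<Rightarrow> real) \<Rightarrow> ('s \<Rightarrow> real) \<Rightarrow> bool" where
  "balance_equation p l \<longleftrightarrow> (\<forall>y. (\<Sum>\<^sub>\<infinity>x. l x * p x y) = l y * (\<Sum>\<^sub>\<infinity>x. p y x))"

definition type_a :: "enat \<Rightarrow> (nat \<Rightarrow> nat \<Rightarrow> real) \<Rightarrow> bool" where
  "type_a N b \<longleftrightarrow> (\<forall>n\<in>occ N. \<forall>k\<in>occ N. b n k = b n 0)"

definition type_b ::
    "enat \<Rightarrow> (nat \<Rightarrow> nat \<Rightarrow> real) \<Rightarrow> ('s \<Rightarrow> 's \<Rightarrow> real) \<Rightarrow> ('s \<Rightarrow> real) \<Rightarrow> bool" where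
  "type_b N b p l \<longleftrightarrow>
     (\<forall>n\<in>occ N. \<forall>k\<in>occ N. b n k - b k n = b n 0 - b k 0) \<and>
     (\<forall>x y. l x * p x y \<noteq> l y * p y x \<longrightarrow> l x = l y)"

definition type_c :: "('s \<Rightarrow> 's \<Rightarrow> real) \<Rightarrow> ('s \<Rightarrow> real) \<Rightarrow> bool" where
  "type_c p l \<longleftrightarrow> (\<forall>x y. l x * p x y = l y * p y x)"


section \<open>Stationarity under the semigroup\<close>

definition markov_semigroup ::
    "enat \<Rightarrow> (real \<Rightarrow> (('s \<Rightarrow> nat) \<Rightarrow> real) \<Rightarrow> ('s \<Rightarrow> nat) \<Rightarrow> real) \<Rightarrow> bool" where
  "markov_semigroup N T \<longleftrightarrow>
     (\<forall>t\<ge>0. \<forall>f\<in>test_closure N. T t f \<in> test_closure N) \<and>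
     (\<forall>t\<ge>0. \<forall>f\<in>test_closure N. \<forall>g\<in>test_closure N. \<forall>c d. \<forall>\<eta>\<in>config N.
        T t (\<lambda>\<zeta>. c * f \<zeta> + d * g \<zeta>) \<eta> = c * T t f \<eta> + d * T t g \<eta>) \<and>
     (\<forall>t\<ge>0. \<forall>f\<in>test_closure N. (\<forall>\<eta>\<in>config N. 0 \<le> f \<eta>) \<longrightarrow> (\<forall>\<eta>\<in>config N. 0 \<le> T t f \<eta>)) \<and>
     (\<forall>t\<ge>0. \<forall>\<eta>\<in>config N. T t (\<lambda>_. 1) \<eta> = 1) \<and>
     (\<forall>f\<in>test_closure N. \<forall>\<eta>\<in>config N. T 0 f \<eta> = f \<eta>) \<and>
     (\<forall>s\<ge>0. \<forall>t\<ge>0. \<forall>f\<in>test_closure N. \<forall>\<eta>\<in>config N. T (s + t) f \<eta> = T s (T t f) \<eta>) \<and>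
     (\<forall>f\<in>test_closure N. uniform_limit (config N) (\<lambda>t. T t f) f (at_right 0))"

definition semigroup_generator ::
    "enat \<Rightarrow> (real \<Rightarrow> (('s \<Rightarrow> nat) \<Rightarrow> real) \<Rightarrow> ('s \<Rightarrow> nat) \<Rightarrow> real) \<Rightarrow>
       ((('s \<Rightarrow> nat) \<Rightarrow> real) \<times> (('s \<Rightarrow> nat) \<Rightarrow> real)) set" where
  "semigroup_generator N T =
     {(f, g). f \<in> test_closure N \<and> g \<in> test_closure N \<and>
        uniform_limit (config N) (\<lambda>t \<eta>. (T t f \<eta> - f \<eta>) / t) g (at_right 0)}"

definition generates_with_core ::
    "enat \<Rightarrow> (nat \<Rightarrow> nat \<Rightarrow> real) \<Rightarrow> ('s \<Rightarrow> 's \<Rightarrow> real) \<Rightarrow>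
       (real \<Rightarrow> (('s \<Rightarrow> nat) \<Rightarrow> real) \<Rightarrow> ('s \<Rightarrow> nat) \<Rightarrow> real) \<Rightarrow> bool" where
  "generates_with_core N b p T \<longleftrightarrow>
     markov_semigroup N T \<and>
     (\<forall>f\<in>test_functions N. (f, generator b p f) \<in> semigroup_generator N T) \<and>
     (\<forall>(f, g)\<in>semigroup_generator N T. \<forall>e>0. \<exists>h\<in>test_functions N. \<forall>\<eta>\<in>config N.
        \<bar>f \<eta> - h \<eta>\<bar> < e \<and> \<bar>g \<eta> - generator b p h \<eta>\<bar> < e)"

definition stationary_measures ::
    "enat \<Rightarrow> (real \<Rightarrow> (('s \<Rightarrow> nat) \<Rightarrow> real) \<Rightarrow> ('s \<Rightarrow> nat) \<Rightarrow> real) \<Rightarrow> ('s \<Rightarrow> nat) measure set" where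
  "stationary_measures N T =
     {\<mu>. prob_space \<mu> \<and> sets \<mu> = sets (config_algebra N) \<and>
         (\<forall>t\<ge>0. \<forall>f\<in>test_closure N. integral\<^sup>L \<mu> (T t f) = integral\<^sup>L \<mu> f)}"

lemma space_config_algebra: "space (config_algebra N) = (config N :: ('s \<Rightarrow> nat) set)"
  by (auto simp: config_algebra_def space_PiM config_def PiE_UNIV_domain)

lemma measurable_test_function:
  fixes f :: "('s::countable \<Rightarrow> nat) \<Rightarrow> real"
  assumes "f \<in> test_functions N"
  shows "f \<in> borel_measurable (config_algebra N)"
proof -
  have "(\<lambda>\<eta>. \<eta>) \<in> measurable (config_algebra N) (PiM UNIV (\<lambda>_::'s. borel :: nat measure))"
  proof (rule measurable_PiM_single')
    fix i :: 's
    have 1: "(\<lambda>\<eta>. \<eta> i) \<in> measurable (config_algebra N :: ('s \<Rightarrow> nat) measure) (count_space (occ N))"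
      unfolding config_algebra_def by (rule measurable_component_singleton) simp
    show "(\<lambda>\<eta>. \<eta> i) \<in> borel_measurable (config_algebra N)"
      by (rule measurable_compose[OF 1, of "\<lambda>n. n"]) simp
  qed auto
  then have "(\<lambda>\<eta>. \<eta>) \<in> measurable (config_algebra N) (borel :: ('s \<Rightarrow> nat) measure)"
    using measurable_cong_sets[OF refl sets_PiM_equal_borel] by blast
  then have "(\<lambda>\<eta>. \<eta>) \<in> measurable (config_algebra N) (restrict_space borel (config N :: ('s \<Rightarrow> nat) set))"
    by (intro measurable_restrict_space2) (auto simp: space_config_algebra)
  moreover have "f \<in> borel_measurable (restrict_space borel (config N))"
    using assms by (intro borel_measurable_continuous_on_restrict) (auto simp: test_functions_def)
  ultimately show ?thesis
    by (rule measurable_compose)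
qed

lemma test_functions_subset_test_closure: "test_functions N \<subseteq> test_closure N"
  unfolding test_closure_def by auto (metis abs_zero diff_self)

lemma measurable_test_closure:
  fixes f :: "('s::countable \<Rightarrow> nat) \<Rightarrow> real"
  assumes "f \<in> test_closure N"
  shows "f \<in> borel_measurable (config_algebra N)"
proof -
  have "\<forall>n. \<exists>g\<in>test_functions N. \<forall>\<eta>\<in>config N. \<bar>f \<eta> - g \<eta>\<bar> < inverse (real (Suc n))"
    using assms unfolding test_closure_def by auto
  then obtain g where g: "\<And>n. g n \<in> test_functions N"
      "\<And>n \<eta>. \<eta> \<in> config N \<Longrightarrow> \<bar>f \<eta> - g n \<eta>\<bar> < inverse (real (Suc n))"
    by metis
  show ?thesis
  proof (rule borel_measurable_LIMSEQ_real)
    show "g n \<in> borel_measurable (config_algebra N)" for n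
      by (rule measurable_test_function[OF g(1)])
    fix \<eta> :: "'s \<Rightarrow> nat"
    assume "\<eta> \<in> space (config_algebra N)"
    then have \<eta>: "\<eta> \<in> config N" by (simp add: space_config_algebra)
    have "(\<lambda>n. g n \<eta> - f \<eta>) \<longlonglongrightarrow> 0"
    proof (rule Lim_null_comparison[OF _ LIMSEQ_inverse_real_of_nat])
      show "\<forall>\<^sub>F n in sequentially. norm (g n \<eta> - f \<eta>) \<le> inverse (real (Suc n))"
        using g(2)[OF \<eta>] by (intro always_eventually) (simp add: abs_minus_commute less_imp_le)
    qed
    then show "(\<lambda>n. g n \<eta>) \<longlonglongrightarrow> f \<eta>" by (simp add: LIM_zero_iff)
  qed
qed

lemma bounded_test_closure:
  assumes "f \<in> test_closure N"
  obtains B where "\<And>\<eta>. \<eta> \<in> config N \<Longrightarrow> \<bar>f \<eta>\<bar> \<le> B"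
proof -
  obtain g where g: "g \<in> test_functions N" "\<And>\<eta>. \<eta> \<in> config N \<Longrightarrow> \<bar>f \<eta> - g \<eta>\<bar> < 1"
    using assms unfolding test_closure_def by (auto dest: spec[of _ 1])
  from g(1) obtain B where B: "\<And>\<eta>. \<eta> \<in> config N \<Longrightarrow> \<bar>g \<eta>\<bar> \<le> B"
    unfolding test_functions_def bounded_iff by auto
  have "\<bar>f \<eta>\<bar> \<le> B + 1" if "\<eta> \<in> config N" for \<eta>
    using B[OF that] g(2)[OF that] by linarith
  then show thesis by (rule that)
qed

lemma integrable_test_closure:
  fixes f :: "('s::countable \<Rightarrow> nat) \<Rightarrow> real"
  assumes "prob_space \<mu>" "sets \<mu> = sets (config_algebra N)" "f \<in> test_closure N"
  shows "integrable \<mu> f"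
proof -
  interpret prob_space \<mu> by fact
  obtain B where B: "\<And>\<eta>. \<eta> \<in> config N \<Longrightarrow> \<bar>f \<eta>\<bar> \<le> B"
    using bounded_test_closure[OF assms(3)] by blast
  have sp: "space \<mu> = config N"
    using sets_eq_imp_space_eq[OF assms(2)] by (simp add: space_config_algebra)
  have "f \<in> borel_measurable \<mu>"
    using measurable_test_closure[OF assms(3)] measurable_cong_sets[OF assms(2) refl] by blast
  then show ?thesis
    by (intro integrable_const_bound[of _ B]) (auto simp: sp B)
qed

lemma integral_diff_le:
  fixes f g :: "('s::countable \<Rightarrow> nat) \<Rightarrow> real"
  assumes "prob_space \<mu>" "sets \<mu> = sets (config_algebra N)"
    and "integrable \<mu> f" "integrable \<mu> g"
    and "\<And>\<eta>. \<eta> \<in> config N \<Longrightarrow> \<bar>f \<eta> - g \<eta>\<bar> \<le> e"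
  shows "\<bar>integral\<^sup>L \<mu> f - integral\<^sup>L \<mu> g\<bar> \<le> e"
proof -
  interpret prob_space \<mu> by fact
  have sp: "space \<mu> = config N"
    using sets_eq_imp_space_eq[OF assms(2)] by (simp add: space_config_algebra)
  have "\<bar>integral\<^sup>L \<mu> f - integral\<^sup>L \<mu> g\<bar> = \<bar>\<integral>\<eta>. f \<eta> - g \<eta> \<partial>\<mu>\<bar>"
    using assms by simp
  also have "\<dots> \<le> (\<integral>\<eta>. \<bar>f \<eta> - g \<eta>\<bar> \<partial>\<mu>)" by (rule integral_abs_bound)
  also have "\<dots> \<le> (\<integral>\<eta>. e \<partial>\<mu>)"
    using assms by (intro integral_mono) (auto simp: sp)
  also have "\<dots> = e" by (simp add: prob_space)
  finally show ?thesis .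
qed


lemma variation_upper:
  assumes "bounded (f ` config N)" "\<eta> \<in> config N" "\<zeta> \<in> config N" "\<And>j. j \<noteq> i \<Longrightarrow> \<eta> j = \<zeta> j"
  shows "\<bar>f \<eta> - f \<zeta>\<bar> \<le> variation N f i"
proof -
  from assms(1) obtain B where B: "\<And>\<eta>. \<eta> \<in> config N \<Longrightarrow> \<bar>f \<eta>\<bar> \<le> B"
    unfolding bounded_iff by auto
  show ?thesis unfolding variation_def
  proof (rule cSup_upper)
    show "bdd_above {\<bar>f \<eta> - f \<zeta>\<bar> |\<eta> \<zeta>. \<eta> \<in> config N \<and> \<zeta> \<in> config N \<and> (\<forall>j. j \<noteq> i \<longrightarrow> \<eta> j = \<zeta> j)}"
    proof (rule bdd_aboveI[of _ "B + B"])
      fix r assume "r \<in> {\<bar>f \<eta> - f \<zeta>\<bar> |\<eta> \<zeta>. \<eta> \<in> config N \<and> \<zeta> \<in> config N \<and> (\<forall>j. j \<noteq> i \<longrightarrow> \<eta> j = \<zeta> j)}"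
      then obtain \<eta> \<zeta> where "r = \<bar>f \<eta> - f \<zeta>\<bar>" "\<eta> \<in> config N" "\<zeta> \<in> config N" by blast
      then show "r \<le> B + B" using B[of \<eta>] B[of \<zeta>] by linarith
    qed
  qed (use assms in blast)
qed

lemma zero_config: "(\<lambda>_. 0) \<in> config N"
  by (simp add: config_def occ_def flip: zero_enat_def)

lemma variation_least:
  assumes "\<And>\<eta> \<zeta>. \<eta> \<in> config N \<Longrightarrow> \<zeta> \<in> config N \<Longrightarrow> (\<And>j. j \<noteq> i \<Longrightarrow> \<eta> j = \<zeta> j) \<Longrightarrow> \<bar>f \<eta> - f \<zeta>\<bar> \<le> c"
  shows "variation N f i \<le> c"
  unfolding variation_def
  by (rule cSup_least) (use zero_config assms in blast)+

lemma variation_nonneg: "bounded (f ` config N) \<Longrightarrow> 0 \<le> variation N f i"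
  using variation_upper[of f N "\<lambda>_. 0" "\<lambda>_. 0" i] zero_config[of N] by simp

lemma const_test_function: "(\<lambda>_::'s \<Rightarrow> nat. c) \<in> test_functions N"
proof -
  have b: "bounded ((\<lambda>_. c) ` (config N :: ('s \<Rightarrow> nat) set))"
    by (auto simp: bounded_iff)
  have "variation N (\<lambda>_. c) = (\<lambda>_::'s. 0)"
  proof
    fix i :: 's
    have "variation N (\<lambda>_. c) i \<le> 0"
      by (rule variation_least) simp
    with b show "variation N (\<lambda>_. c) i = 0"
      using variation_nonneg[of "\<lambda>_. c" N i] by simp
  qed
  with b show ?thesis by (simp add: test_functions_def)
qed

lemma linear_test_functions:
  assumes f: "f \<in> test_functions N" and g: "g \<in> test_functions N"
  shows "(\<lambda>\<eta>. c * f \<eta> + d * g \<eta>) \<in> test_functions N"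
proof -
  have bf: "bounded (f ` config N)" and bg: "bounded (g ` config N)"
    and cf: "continuous_on (config N) f" and cg: "continuous_on (config N) g"
    and sf: "variation N f summable_on UNIV" and sg: "variation N g summable_on UNIV"
    using f g by (auto simp: test_functions_def)
  have b: "bounded ((\<lambda>\<eta>. c * f \<eta> + d * g \<eta>) ` config N)"
    using bounded_plus_comp[OF bounded_scaleR_comp[OF bf, of c] bounded_scaleR_comp[OF bg, of d]]
    by simp
  have le: "variation N (\<lambda>\<eta>. c * f \<eta> + d * g \<eta>) i \<le> \<bar>c\<bar> * variation N f i + \<bar>d\<bar> * variation N g i"
    for i
  proof (rule variation_least)
    fix \<eta> \<zeta> :: "'a \<Rightarrow> nat"
    assume *: "\<eta> \<in> config N" "\<zeta> \<in> config N" "\<And>j. j \<noteq> i \<Longrightarrow> \<eta> j = \<zeta> j"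
    have "\<bar>c * f \<eta> + d * g \<eta> - (c * f \<zeta> + d * g \<zeta>)\<bar> = \<bar>c * (f \<eta> - f \<zeta>) + d * (g \<eta> - g \<zeta>)\<bar>"
      by (simp add: algebra_simps)
    also have "\<dots> \<le> \<bar>c\<bar> * \<bar>f \<eta> - f \<zeta>\<bar> + \<bar>d\<bar> * \<bar>g \<eta> - g \<zeta>\<bar>"
      by (rule order_trans[OF abs_triangle_ineq]) (simp add: abs_mult)
    also have "\<dots> \<le> \<bar>c\<bar> * variation N f i + \<bar>d\<bar> * variation N g i"
      by (intro add_mono mult_left_mono variation_upper bf bg *) auto
    finally show "\<bar>c * f \<eta> + d * g \<eta> - (c * f \<zeta> + d * g \<zeta>)\<bar>
      \<le> \<bar>c\<bar> * variation N f i + \<bar>d\<bar> * variation N g i" .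
  qed
  have "variation N (\<lambda>\<eta>. c * f \<eta> + d * g \<eta>) summable_on UNIV"
    by (rule summable_on_comparison_test[where f = "\<lambda>i. \<bar>c\<bar> * variation N f i + \<bar>d\<bar> * variation N g i"])
      (auto intro!: summable_on_add summable_on_cmult_right sf sg le variation_nonneg[OF b])
  then show ?thesis
    using b by (auto simp: test_functions_def intro!: continuous_intros cf cg)
qed

lemma linear_test_closure:
  assumes f: "f \<in> test_closure N" and g: "g \<in> test_closure N"
  shows "(\<lambda>\<eta>. c * f \<eta> + d * g \<eta>) \<in> test_closure N"
  unfolding test_closure_def
proof (intro CollectI allI impI)
  fix e :: real assume e: "0 < e"
  define k where "k = e / (\<bar>c\<bar> + \<bar>d\<bar> + 1)"
  have k: "0 < k" using e by (simp add: k_def)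
  obtain u v where u: "u \<in> test_functions N" "\<And>\<eta>. \<eta> \<in> config N \<Longrightarrow> \<bar>f \<eta> - u \<eta>\<bar> < k"
    and v: "v \<in> test_functions N" "\<And>\<eta>. \<eta> \<in> config N \<Longrightarrow> \<bar>g \<eta> - v \<eta>\<bar> < k"
    using f g k unfolding test_closure_def by blast
  have "\<bar>c * f \<eta> + d * g \<eta> - (c * u \<eta> + d * v \<eta>)\<bar> < e" if \<eta>: "\<eta> \<in> config N" for \<eta>
  proof -
    have "\<bar>c * f \<eta> + d * g \<eta> - (c * u \<eta> + d * v \<eta>)\<bar> = \<bar>c * (f \<eta> - u \<eta>) + d * (g \<eta> - v \<eta>)\<bar>"
      by (simp add: algebra_simps)
    also have "\<dots> \<le> \<bar>c\<bar> * \<bar>f \<eta> - u \<eta>\<bar> + \<bar>d\<bar> * \<bar>g \<eta> - v \<eta>\<bar>"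
      by (rule order_trans[OF abs_triangle_ineq]) (simp add: abs_mult)
    also have "\<dots> \<le> \<bar>c\<bar> * k + \<bar>d\<bar> * k"
      using u(2)[OF \<eta>] v(2)[OF \<eta>] by (intro add_mono mult_left_mono) auto
    also have "\<dots> < (\<bar>c\<bar> + \<bar>d\<bar> + 1) * k" using k by (simp add: algebra_simps)
    also have "\<dots> = e" by (simp add: k_def add_nonneg_pos)
    finally show ?thesis .
  qed
  then show "\<exists>h\<in>test_functions N. \<forall>\<eta>\<in>config N. \<bar>c * f \<eta> + d * g \<eta> - h \<eta>\<bar> < e"
    by (intro bexI[OF _ linear_test_functions[OF u(1) v(1), of c d]] ballI)
qed

lemma
  assumes "markov_semigroup N T"
  shows semigroup_closed: "\<forall>t\<ge>0. \<forall>f\<in>test_closure N. T t f \<in> test_closure N"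
    and semigroup_linear: "\<forall>t\<ge>0. \<forall>f\<in>test_closure N. \<forall>g\<in>test_closure N. \<forall>c d. \<forall>\<eta>\<in>config N.
      T t (\<lambda>\<zeta>. c * f \<zeta> + d * g \<zeta>) \<eta> = c * T t f \<eta> + d * T t g \<eta>"
    and semigroup_positive: "\<forall>t\<ge>0. \<forall>f\<in>test_closure N. (\<forall>\<eta>\<in>config N. 0 \<le> f \<eta>) \<longrightarrow> (\<forall>\<eta>\<in>config N. 0 \<le> T t f \<eta>)"
    and semigroup_unit: "\<forall>t\<ge>0. \<forall>\<eta>\<in>config N. T t (\<lambda>_. 1) \<eta> = 1"
    and semigroup_zero: "\<forall>f\<in>test_closure N. \<forall>\<eta>\<in>config N. T 0 f \<eta> = f \<eta>"
    and semigroup_add: "\<forall>s\<ge>0. \<forall>t\<ge>0. \<forall>f\<in>test_closure N. \<forall>\<eta>\<in>config N. T (s + t) f \<eta> = T s (T t f) \<eta>"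
  by (insert assms[unfolded markov_semigroup_def]) (elim conjE, assumption)+

lemma semigroup_contraction:
  assumes T: "markov_semigroup N T" and t: "0 \<le> t"
    and f: "f \<in> test_closure N" and g: "g \<in> test_closure N"
    and le: "\<And>\<eta>. \<eta> \<in> config N \<Longrightarrow> \<bar>f \<eta> - g \<eta>\<bar> \<le> e"
    and \<eta>: "\<eta> \<in> config N"
  shows "\<bar>T t f \<eta> - T t g \<eta>\<bar> \<le> e"
proof -
  have one: "(\<lambda>_. 1) \<in> test_closure N"
    using const_test_function test_functions_subset_test_closure by blast
  have lin: "T t (\<lambda>\<zeta>. c * u \<zeta> + d * v \<zeta>) \<eta> = c * T t u \<eta> + d * T t v \<eta>"
    if "u \<in> test_closure N" "v \<in> test_closure N" for c d u v
    using semigroup_linear[OF T] t \<eta> that by blast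
  have unit: "T t (\<lambda>_. 1) \<eta> = 1"
    using semigroup_unit[OF T] t \<eta> by blast
  have main: "T t v \<eta> - T t u \<eta> \<le> e"
    if u: "u \<in> test_closure N" and v: "v \<in> test_closure N"
      and le: "\<And>\<eta>. \<eta> \<in> config N \<Longrightarrow> v \<eta> - u \<eta> \<le> e" for u v
  proof -
    let ?w = "\<lambda>\<zeta>. 1 * u \<zeta> + (-1) * v \<zeta>"
    let ?z = "\<lambda>\<zeta>. e * 1 + 1 * ?w \<zeta>"
    have w: "?w \<in> test_closure N" by (rule linear_test_closure[OF u v])
    have z: "?z \<in> test_closure N" by (rule linear_test_closure[OF one w])
    have "\<forall>\<eta>\<in>config N. 0 \<le> ?z \<eta>" using le by (simp add: algebra_simps)
    then have "0 \<le> T t ?z \<eta>"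
      using semigroup_positive[OF T, rule_format, OF t z] \<eta> by auto
    also have "T t ?z \<eta> = e * T t (\<lambda>_. 1) \<eta> + 1 * T t ?w \<eta>" by (rule lin[OF one w])
    also have "T t ?w \<eta> = 1 * T t u \<eta> + (-1) * T t v \<eta>" by (rule lin[OF u v])
    finally show ?thesis using unit by simp
  qed
  have "T t f \<eta> - T t g \<eta> \<le> e"
    using le by (intro main f g) (auto simp: abs_le_iff)
  moreover have "T t g \<eta> - T t f \<eta> \<le> e"
    by (rule main[OF f g]) (use le in \<open>force simp: abs_le_iff\<close>)
  ultimately show ?thesis by linarith
qed

lemma semigroup_expansion:
  assumes T: "markov_semigroup N T" and fg: "(f, g) \<in> semigroup_generator N T" and e: "0 < e"
  shows "\<exists>\<delta>>0. \<forall>h t. 0 < h \<longrightarrow> h < \<delta> \<longrightarrow> 0 \<le> t \<longrightarrow>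
    (\<forall>\<eta>\<in>config N. \<bar>T (t + h) f \<eta> - (T t f \<eta> + h * T t g \<eta>)\<bar> \<le> e * h)"
proof -
  have f: "f \<in> test_closure N" and g: "g \<in> test_closure N"
    and lim: "uniform_limit (config N) (\<lambda>t \<eta>. (T t f \<eta> - f \<eta>) / t) g (at_right 0)"
    using fg by (auto simp: semigroup_generator_def)
  from uniform_limitD[OF lim e] obtain \<delta> where \<delta>: "0 < \<delta>"
    "\<And>h \<eta>. 0 < h \<Longrightarrow> h < \<delta> \<Longrightarrow> \<eta> \<in> config N \<Longrightarrow> \<bar>(T h f \<eta> - f \<eta>) / h - g \<eta>\<bar> < e"
    unfolding eventually_at_right_field dist_real_def by auto
  have "\<bar>T (t + h) f \<eta> - (T t f \<eta> + h * T t g \<eta>)\<bar> \<le> e * h"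
    if h: "0 < h" "h < \<delta>" and t: "0 \<le> t" and \<eta>: "\<eta> \<in> config N" for h t \<eta>
  proof -
    let ?u = "\<lambda>\<zeta>. 1 * f \<zeta> + h * g \<zeta>"
    have u: "?u \<in> test_closure N" by (rule linear_test_closure[OF f g])
    have Tf: "T h f \<in> test_closure N"
      using semigroup_closed[OF T] h f by simp
    have "\<bar>T h f \<zeta> - ?u \<zeta>\<bar> \<le> e * h" if \<zeta>: "\<zeta> \<in> config N" for \<zeta>
    proof -
      have "T h f \<zeta> - ?u \<zeta> = ((T h f \<zeta> - f \<zeta>) / h - g \<zeta>) * h"
        using h by (simp add: field_simps)
      then have "\<bar>T h f \<zeta> - ?u \<zeta>\<bar> = \<bar>(T h f \<zeta> - f \<zeta>) / h - g \<zeta>\<bar> * h"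
        using h by (simp add: abs_mult)
      also have "\<dots> \<le> e * h"
        using \<delta>(2)[OF h \<zeta>] h by (intro mult_right_mono) auto
      finally show ?thesis .
    qed
    then have "\<bar>T t (T h f) \<eta> - T t ?u \<eta>\<bar> \<le> e * h"
      by (rule semigroup_contraction[OF T t Tf u _ \<eta>])
    moreover have "T t ?u \<eta> = 1 * T t f \<eta> + h * T t g \<eta>"
      using semigroup_linear[OF T] t f g \<eta> by blast
    moreover have "T (t + h) f \<eta> = T t (T h f) \<eta>"
      using semigroup_add[OF T] t h f \<eta> by simp
    ultimately show ?thesis by simp
  qed
  with \<delta>(1) show ?thesis by auto
qed

lemma semigroup_generator_invariant:
  assumes T: "markov_semigroup N T" and fg: "(f, g) \<in> semigroup_generator N T" and t: "0 \<le> t"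
  shows "(T t f, T t g) \<in> semigroup_generator N T"
proof -
  have f: "f \<in> test_closure N" and g: "g \<in> test_closure N"
    using fg by (auto simp: semigroup_generator_def)
  have Tt: "T t u \<in> test_closure N" if "u \<in> test_closure N" for u
    using semigroup_closed[OF T] t that by blast
  have "uniform_limit (config N) (\<lambda>h \<eta>. (T h (T t f) \<eta> - T t f \<eta>) / h) (T t g) (at_right 0)"
  proof (rule uniform_limitI)
    fix e :: real assume e: "0 < e"
    then have e2: "0 < e / 2" by simp
    obtain \<delta> where \<delta>: "0 < \<delta>"
      "\<And>h t \<eta>. 0 < h \<Longrightarrow> h < \<delta> \<Longrightarrow> 0 \<le> t \<Longrightarrow> \<eta> \<in> config N \<Longrightarrow>
         \<bar>T (t + h) f \<eta> - (T t f \<eta> + h * T t g \<eta>)\<bar> \<le> e / 2 * h"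
      using semigroup_expansion[OF T fg e2] by auto
    have "dist ((T h (T t f) \<eta> - T t f \<eta>) / h) (T t g \<eta>) < e"
      if h: "0 < h" "h < \<delta>" and \<eta>: "\<eta> \<in> config N" for h \<eta>
    proof -
      have "T (h + t) f \<eta> = T h (T t f) \<eta>"
        using semigroup_add[OF T] t h f \<eta> by simp
      then have "(T h (T t f) \<eta> - T t f \<eta>) / h - T t g \<eta>
          = (T (t + h) f \<eta> - (T t f \<eta> + h * T t g \<eta>)) / h"
        using h by (simp add: field_simps)
      also have "\<bar>\<dots>\<bar> \<le> e / 2"
        using \<delta>(2)[OF h t \<eta>] h by (simp add: pos_divide_le_eq)
      also have "\<dots> < e" using e by simp
      finally show ?thesis by (simp add: dist_real_def)
    qed
    then show "\<forall>\<^sub>F h in at_right 0. \<forall>\<eta>\<in>config N. dist ((T h (T t f) \<eta> - T t f \<eta>) / h) (T t g \<eta>) < e"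
      unfolding eventually_at_right_field using \<delta>(1) by blast
  qed
  then show ?thesis using Tt f g by (simp add: semigroup_generator_def)
qed

theorem stationary_measures_eq_invariant_measures:
  fixes p :: "'s::countable \<Rightarrow> 's \<Rightarrow> real"
  assumes "generates_with_core N b p T"
  shows "stationary_measures N T = invariant_measures N b p"
proof (intro equalityI subsetI)
  have T: "markov_semigroup N T"
    and gen: "\<And>f. f \<in> test_functions N \<Longrightarrow> (f, generator b p f) \<in> semigroup_generator N T"
    and core: "\<And>f g e. (f, g) \<in> semigroup_generator N T \<Longrightarrow> 0 < e \<Longrightarrow>
      \<exists>h\<in>test_functions N. \<forall>\<eta>\<in>config N. \<bar>f \<eta> - h \<eta>\<bar> < e \<and> \<bar>g \<eta> - generator b p h \<eta>\<bar> < e"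
    using assms unfolding generates_with_core_def by blast+
  have Tt: "T t u \<in> test_closure N" if "0 \<le> t" "u \<in> test_closure N" for t u
    using semigroup_closed[OF T] that by blast
  have dom: "f \<in> test_closure N" "g \<in> test_closure N" if "(f, g) \<in> semigroup_generator N T" for f g
    using that by (auto simp: semigroup_generator_def)
  note [intro] = dom Tt
  {
    fix \<mu> :: "('s \<Rightarrow> nat) measure"
    assume "\<mu> \<in> stationary_measures N T"
    then have \<mu>: "prob_space \<mu>" "sets \<mu> = sets (config_algebra N)"
      and st: "\<And>t f. 0 \<le> t \<Longrightarrow> f \<in> test_closure N \<Longrightarrow> integral\<^sup>L \<mu> (T t f) = integral\<^sup>L \<mu> f"
      by (auto simp: stationary_measures_def)
    note int = integrable_test_closure[OF \<mu>]
    have "integral\<^sup>L \<mu> (generator b p f) = 0" if "f \<in> test_functions N" for f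
    proof -
      let ?g = "generator b p f"
      have fg: "(f, ?g) \<in> semigroup_generator N T" by (rule gen[OF that])
      have "\<bar>integral\<^sup>L \<mu> ?g\<bar> \<le> e" if e: "0 < e" for e
      proof -
        obtain \<delta> where \<delta>: "0 < \<delta>"
          "\<And>h t \<eta>. 0 < h \<Longrightarrow> h < \<delta> \<Longrightarrow> 0 \<le> t \<Longrightarrow> \<eta> \<in> config N \<Longrightarrow>
             \<bar>T (t + h) f \<eta> - (T t f \<eta> + h * T t ?g \<eta>)\<bar> \<le> e * h"
          using semigroup_expansion[OF T fg e] by auto
        define h where "h = \<delta> / 2"
        have h: "0 < h" "h < \<delta>" using \<delta>(1) by (auto simp: h_def)
        have i: "integrable \<mu> (T h f)" "integrable \<mu> (T 0 f)" "integrable \<mu> (T 0 ?g)"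
          using h fg by (auto intro!: int)
        have "\<bar>integral\<^sup>L \<mu> (T h f) - integral\<^sup>L \<mu> (\<lambda>\<eta>. T 0 f \<eta> + h * T 0 ?g \<eta>)\<bar> \<le> e * h"
          using \<delta>(2)[OF h, of 0] i by (intro integral_diff_le[OF \<mu>]) auto
        also have "integral\<^sup>L \<mu> (\<lambda>\<eta>. T 0 f \<eta> + h * T 0 ?g \<eta>)
            = integral\<^sup>L \<mu> (T 0 f) + h * integral\<^sup>L \<mu> (T 0 ?g)"
          using i by simp
        finally show ?thesis
          using h fg by (simp add: st dom[OF fg] abs_mult)
      qed
      then show ?thesis using field_le_epsilon[of "\<bar>integral\<^sup>L \<mu> ?g\<bar>" 0] by simp
    qed
    with \<mu> show "\<mu> \<in> invariant_measures N b p" by (simp add: invariant_measures_def)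
  next
    fix \<mu> :: "('s \<Rightarrow> nat) measure"
    assume "\<mu> \<in> invariant_measures N b p"
    then have \<mu>: "prob_space \<mu>" "sets \<mu> = sets (config_algebra N)"
      and inv: "\<And>f. f \<in> test_functions N \<Longrightarrow> integral\<^sup>L \<mu> (generator b p f) = 0"
      by (auto simp: invariant_measures_def)
    note int = integrable_test_closure[OF \<mu>]
    have null: "integral\<^sup>L \<mu> g = 0" if fg: "(f, g) \<in> semigroup_generator N T" for f g
    proof -
      have "\<bar>integral\<^sup>L \<mu> g\<bar> \<le> e" if e: "0 < e" for e
      proof -
        obtain h where h: "h \<in> test_functions N"
          "\<And>\<eta>. \<eta> \<in> config N \<Longrightarrow> \<bar>g \<eta> - generator b p h \<eta>\<bar> < e"
          using core[OF fg e] by blast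
        have "\<bar>integral\<^sup>L \<mu> g - integral\<^sup>L \<mu> (generator b p h)\<bar> \<le> e"
          using fg gen[OF h(1)] h(2)
          by (intro integral_diff_le[OF \<mu>]) (auto intro!: int simp: less_imp_le)
        then show ?thesis by (simp add: inv[OF h(1)])
      qed
      then show ?thesis using field_le_epsilon[of "\<bar>integral\<^sup>L \<mu> g\<bar>" 0] by simp
    qed
    have st: "integral\<^sup>L \<mu> (T t f) = integral\<^sup>L \<mu> f" if t: "0 < t" and fg: "(f, g) \<in> semigroup_generator N T"
      for t f g
    proof -
      have "\<bar>integral\<^sup>L \<mu> (T t f) - integral\<^sup>L \<mu> f\<bar> \<le> e" if e: "0 < e" for e
      proof -
        have et: "0 < e / t" using e t by simp
        obtain \<delta> where \<delta>: "0 < \<delta>"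
          "\<And>h s \<eta>. 0 < h \<Longrightarrow> h < \<delta> \<Longrightarrow> 0 \<le> s \<Longrightarrow> \<eta> \<in> config N \<Longrightarrow>
             \<bar>T (s + h) f \<eta> - (T s f \<eta> + h * T s g \<eta>)\<bar> \<le> e / t * h"
          using semigroup_expansion[OF T fg et] by auto
        obtain n :: nat where n: "t / \<delta> < real n" using reals_Archimedean2 by blast
        have n0: "0 < real n" using n t \<delta>(1) by (meson divide_pos_pos less_trans)
        define h where "h = t / real n"
        have h: "0 < h" "h < \<delta>" using n n0 t \<delta>(1) by (auto simp: h_def field_simps)
        have step: "\<bar>integral\<^sup>L \<mu> (T (s + h) f) - integral\<^sup>L \<mu> (T s f)\<bar> \<le> e / t * h" if s: "0 \<le> s" for s
        proof -
          have i: "integrable \<mu> (T (s + h) f)" "integrable \<mu> (T s f)" "integrable \<mu> (T s g)"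
            using h s fg by (auto intro!: int)
          have "\<bar>integral\<^sup>L \<mu> (T (s + h) f) - integral\<^sup>L \<mu> (\<lambda>\<eta>. T s f \<eta> + h * T s g \<eta>)\<bar> \<le> e / t * h"
            using \<delta>(2)[OF h s] i by (intro integral_diff_le[OF \<mu>]) auto
          also have "integral\<^sup>L \<mu> (\<lambda>\<eta>. T s f \<eta> + h * T s g \<eta>) = integral\<^sup>L \<mu> (T s f)"
            using i null[OF semigroup_generator_invariant[OF T fg s]] by simp
          finally show ?thesis .
        qed
        have "\<bar>integral\<^sup>L \<mu> (T (real k * h) f) - integral\<^sup>L \<mu> (T 0 f)\<bar> \<le> real k * (e / t * h)" for k
        proof (induction k)
          case (Suc k)
          have 1: "real (Suc k) * h = real k * h + h"
            and 2: "real (Suc k) * (e / t * h) = real k * (e / t * h) + e / t * h"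
            by (simp_all only: of_nat_Suc distrib_right mult_1_left)
          have "0 \<le> real k * h" using h by simp
          from step[OF this] Suc show ?case unfolding 1 2 by linarith
        qed simp
        from this[of n] have "\<bar>integral\<^sup>L \<mu> (T t f) - integral\<^sup>L \<mu> (T 0 f)\<bar> \<le> e"
          using n0 t by (simp add: h_def)
        moreover have "integral\<^sup>L \<mu> (T 0 f) = integral\<^sup>L \<mu> f"
        proof (rule Bochner_Integration.integral_cong[OF refl])
          fix \<eta> assume "\<eta> \<in> space \<mu>"
          then have "\<eta> \<in> config N"
            using sets_eq_imp_space_eq[OF \<mu>(2)] by (simp add: space_config_algebra)
          then show "T 0 f \<eta> = f \<eta>" using semigroup_zero[OF T] dom(1)[OF fg] by blast
        qed
        ultimately show ?thesis by simp
      qed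
      then show ?thesis
        using field_le_epsilon[of "\<bar>integral\<^sup>L \<mu> (T t f) - integral\<^sup>L \<mu> f\<bar>" 0] by simp
    qed
    have "integral\<^sup>L \<mu> (T t f) = integral\<^sup>L \<mu> f" if t: "0 \<le> t" and f: "f \<in> test_closure N" for t f
    proof (cases "t = 0")
      case True
      show ?thesis
      proof (rule Bochner_Integration.integral_cong[OF refl])
        fix \<eta> assume "\<eta> \<in> space \<mu>"
        then have "\<eta> \<in> config N"
          using sets_eq_imp_space_eq[OF \<mu>(2)] by (simp add: space_config_algebra)
        then show "T t f \<eta> = f \<eta>" using semigroup_zero[OF T] f True by blast
      qed
    next
      case False
      have "\<bar>integral\<^sup>L \<mu> (T t f) - integral\<^sup>L \<mu> f\<bar> \<le> e" if e: "0 < e" for e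
      proof -
        have "0 < e / 2" using e by simp
        then obtain h where h: "h \<in> test_functions N" "\<And>\<eta>. \<eta> \<in> config N \<Longrightarrow> \<bar>f \<eta> - h \<eta>\<bar> < e / 2"
          using f unfolding test_closure_def by blast
        have hc: "h \<in> test_closure N" using h(1) test_functions_subset_test_closure by blast
        have "\<bar>integral\<^sup>L \<mu> f - integral\<^sup>L \<mu> h\<bar> \<le> e / 2"
          using h(2) f hc by (intro integral_diff_le[OF \<mu>]) (auto intro!: int simp: less_imp_le)
        moreover have "\<bar>integral\<^sup>L \<mu> (T t f) - integral\<^sup>L \<mu> (T t h)\<bar> \<le> e / 2"
          using f hc t semigroup_contraction[OF T t f hc less_imp_le[OF h(2)]]
          by (intro integral_diff_le[OF \<mu>]) (auto intro!: int)
        moreover have "integral\<^sup>L \<mu> (T t h) = integral\<^sup>L \<mu> h"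
          using st[OF _ gen[OF h(1)]] t False by simp
        ultimately show ?thesis by linarith
      qed
      then show ?thesis
        using field_le_epsilon[of "\<bar>integral\<^sup>L \<mu> (T t f) - integral\<^sup>L \<mu> f\<bar>" 0] by simp
    qed
    with \<mu> show "\<mu> \<in> stationary_measures N T" by (simp add: stationary_measures_def)
  }
qed

end

theory Submission
  imports Defs
begin

text \<open>
  The measure \<open>\<mu>\<close> with parameters \<open>l\<close> is invariant iff \<open>\<integral> L f d\<mu> = 0\<close> for all test functions \<open>f\<close>.
  The algebraic relation for \<open>b\<close> is exactly what makes the one-site weights satisfy a
  detailed balance relation for a single jump: moving a particle from \<open>x\<close> to \<open>y\<close> transforms the
  measure \<open>b (\<eta> x) (\<eta> y) d\<mu>\<close> into \<open>(l x / l y) * b (\<eta> y) (\<eta> x) d\<mu>\<close> (\<open>jump_exchange\<close>).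
  Hence, for a function \<open>f\<close> of finitely many sites and strictly positive \<open>l\<close>,
  all jumps can be removed from the argument of \<open>f\<close>, and what remains is a finite sum
  \<open>\<integral> L f d\<mu> = (\<Sum>(x, y). net_flow x y / l x * \<integral> b (\<eta> x) (\<eta> y) * f \<eta> d\<mu>)\<close>
  with the antisymmetric flow \<open>net_flow x y = l y * p y x - l x * p x y\<close>
  (\<open>total_flux_local\<close>). The balance equation says that this flow has divergence zero.
  
  For sufficiency one may assume that \<open>f\<close> has mean zero. Under (c) the flow vanishes. Under (a) the
  rate depends on \<open>\<eta> x\<close> only; summing over \<open>y\<close> first gives zero for the sites \<open>x\<close> that \<open>f\<close> depends
  on, and for all other sites the rate is independent of \<open>f\<close>, which has mean zero
  (\<open>balance_kills_one_site_rates\<close>). Under (b) the coefficient \<open>net_flow x y / l x\<close> is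
  antisymmetric, so only the antisymmetric part of the rate matters, which agrees with that of
  \<open>b (\<eta> x) 0\<close>; this reduces (b) to the sum from (a). General test functions are limits of functions
  of finitely many sites, with a summable domination (\<open>total_flux_local_dense\<close>).
  
  For necessity, inserting the indicator of \<open>\<eta> u = m \<and> \<eta> v = n\<close> shows that
  \<open>net_flow u v / l u * b m n + net_flow v u / l v * b n m\<close> is a function of \<open>m\<close> plus a function of
  \<open>n\<close> (\<open>two_site_separation\<close>), because every other term involves only one of the two
  sites. If the flow from \<open>u\<close> to \<open>v\<close> does not vanish, this forces
  \<open>l v * (b m n - b m 0) = l u * (b n m - b n 0)\<close>, which is a linear system that leaves only (a) or
  \<open>l u = l v\<close> together with the symmetry in (b) (\<open>invariant_type\<close>). The balance equation then follows
  from the indicator of \<open>\<eta> u = 0\<close> (\<open>invariant_balance\<close>).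
  
  If \<open>l\<close> vanishes at one site then it vanishes everywhere, both under the balance equation and
  under invariance, since a particle arriving at an empty site from a site with \<open>l > 0\<close> could not
  be compensated; irreducibility carries this through the whole of \<open>S\<close>. The measure is then
  concentrated on the empty configuration, where nothing moves.
\<close>


section \<open>Configurations and bounded observables\<close>

lemma occ_downward: "n \<in> occ N \<Longrightarrow> k \<le> n \<Longrightarrow> k \<in> occ N"
  by (auto simp: occ_def intro: order_trans[of "enat k" "enat n"])

lemma zero_in_occ: "0 \<in> occ N"
  by (simp add: occ_def flip: zero_enat_def)

lemma Suc_in_occ_iff: "Suc n \<in> occ N \<longleftrightarrow> n \<in> occ N \<and> enat n \<noteq> N"
  by (cases N) (auto simp: occ_def)

lemma config_update: "\<eta> \<in> config N \<Longrightarrow> n \<in> occ N \<Longrightarrow> \<eta>(x := n) \<in> config N"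
  by (auto simp: config_def)

lemma measurable_occupation:
  "(\<lambda>\<eta>. \<eta> x) \<in> measurable (config_algebra N) (count_space (occ N))"
  unfolding config_algebra_def by (rule measurable_component_singleton) simp

text \<open>
  The update is needed as a measurable function of the configuration and the new value
  jointly, since the new value will be integrated out as well.
\<close>

lemma measurable_update:
  "(\<lambda>(n, \<eta>). \<eta>(x := n)) \<in> measurable (count_space (occ N) \<Otimes>\<^sub>M config_algebra N)
     (config_algebra N :: ('s \<Rightarrow> nat) measure)"
proof -
  have "(\<lambda>\<omega>. (snd \<omega>)(x := fst \<omega>)) \<in>
      measurable (count_space (occ N) \<Otimes>\<^sub>M config_algebra N)
        (PiM UNIV (\<lambda>_::'s. count_space (occ N)))"
    unfolding config_algebra_def by (rule measurable_fun_upd[where J=UNIV]) auto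
  then show ?thesis
    by (simp add: split_beta' flip: config_algebra_def)
qed

lemma measurable_update_const:
  assumes "n \<in> occ N"
  shows "(\<lambda>\<eta>. \<eta>(x := n)) \<in> measurable (config_algebra N) (config_algebra N)"
proof -
  have "(\<lambda>\<eta>. (n, \<eta>)) \<in> measurable (config_algebra N) (count_space (occ N) \<Otimes>\<^sub>M config_algebra N)"
    using assms by simp
  from measurable_compose[OF this measurable_update[of x N]] show ?thesis by simp
qed

text \<open>
  The class of functions to which the integral identities below apply. It contains the test
  functions and, unlike these, is visibly closed under composition with measurable changes of the
  configuration.
\<close>

definition observable :: "enat \<Rightarrow> (('s \<Rightarrow> nat) \<Rightarrow> real) \<Rightarrow> bool" where
  "observable N f \<longleftrightarrow> f \<in> borel_measurable (config_algebra N) \<and> bounded (f ` config N)"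

lemma observable_measurable: "observable N f \<Longrightarrow> f \<in> borel_measurable (config_algebra N)"
  by (simp add: observable_def)

lemma observableI:
  assumes "f \<in> borel_measurable (config_algebra N)" "\<And>\<eta>. \<eta> \<in> config N \<Longrightarrow> \<bar>f \<eta>\<bar> \<le> B"
  shows "observable N f"
  using assms unfolding observable_def bounded_iff by auto

lemma observable_bound:
  assumes "observable N f"
  obtains B where "0 \<le> B" "\<And>\<eta>. \<eta> \<in> config N \<Longrightarrow> \<bar>f \<eta>\<bar> \<le> B"
proof -
  obtain B where "\<And>\<eta>. \<eta> \<in> config N \<Longrightarrow> \<bar>f \<eta>\<bar> \<le> B"
    using assms unfolding observable_def bounded_iff by auto
  then have "\<And>\<eta>. \<eta> \<in> config N \<Longrightarrow> \<bar>f \<eta>\<bar> \<le> max 0 B" by fastforce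
  then show thesis using that[of "max 0 B"] by simp
qed

lemma observable_test_function:
  fixes f :: "('s::countable \<Rightarrow> nat) \<Rightarrow> real"
  shows "f \<in> test_functions N \<Longrightarrow> observable N f"
  using measurable_test_function[of f N] by (simp add: observable_def test_functions_def)

lemma observable_mult:
  assumes f: "observable N f" and g: "observable N g"
  shows "observable N (\<lambda>\<eta>. f \<eta> * g \<eta>)"
proof -
  obtain B where B: "0 \<le> B" "\<And>\<eta>. \<eta> \<in> config N \<Longrightarrow> \<bar>f \<eta>\<bar> \<le> B" using observable_bound[OF f] by blast
  obtain C where C: "0 \<le> C" "\<And>\<eta>. \<eta> \<in> config N \<Longrightarrow> \<bar>g \<eta>\<bar> \<le> C" using observable_bound[OF g] by blast
  show ?thesis
    using borel_measurable_times[OF f[THEN observable_measurable] g[THEN observable_measurable]]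
    by (rule observableI[where B="B * C"]) (auto simp: abs_mult intro!: mult_mono B C)
qed

lemma observable_diff:
  assumes f: "observable N f" and g: "observable N g"
  shows "observable N (\<lambda>\<eta>. f \<eta> - g \<eta>)"
proof -
  obtain B where B: "0 \<le> B" "\<And>\<eta>. \<eta> \<in> config N \<Longrightarrow> \<bar>f \<eta>\<bar> \<le> B" using observable_bound[OF f] by blast
  obtain C where C: "0 \<le> C" "\<And>\<eta>. \<eta> \<in> config N \<Longrightarrow> \<bar>g \<eta>\<bar> \<le> C" using observable_bound[OF g] by blast
  have "\<bar>f \<eta> - g \<eta>\<bar> \<le> B + C" if "\<eta> \<in> config N" for \<eta>
    using B(2)[OF that] C(2)[OF that] by linarith
  then show ?thesis
    using borel_measurable_diff[OF f[THEN observable_measurable] g[THEN observable_measurable]]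
    by (intro observableI[where B="B + C"])
qed

lemma observable_const: "observable N (\<lambda>_. c)"
  by (rule observableI[where B="\<bar>c\<bar>"]) auto

lemma observable_compose:
  assumes f: "observable N f" and J: "J \<in> measurable (config_algebra N) (config_algebra N)"
  shows "observable N (\<lambda>\<eta>. f (J \<eta>))"
proof -
  obtain B where B: "0 \<le> B" "\<And>\<eta>. \<eta> \<in> config N \<Longrightarrow> \<bar>f \<eta>\<bar> \<le> B" using observable_bound[OF f] by blast
  show ?thesis
    by (rule observableI[where B=B], rule measurable_compose[OF J observable_measurable[OF f]])
      (use measurable_space[OF J] B in \<open>simp add: space_config_algebra\<close>)
qed

lemma observable_update: "observable N f \<Longrightarrow> n \<in> occ N \<Longrightarrow> observable N (\<lambda>\<eta>. f (\<eta>(x := n)))"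
  by (rule observable_compose[OF _ measurable_update_const])

lemma measurable_two_sites:
  assumes "\<And>n k. n \<in> occ N \<Longrightarrow> k \<in> occ N \<Longrightarrow> h n k \<in> space M"
  shows "(\<lambda>\<eta>. h (\<eta> x) (\<eta> y)) \<in> measurable (config_algebra N) M"
proof -
  have "(\<lambda>\<eta>. (\<eta> x, \<eta> y)) \<in> measurable (config_algebra N) (count_space (occ N) \<Otimes>\<^sub>M count_space (occ N))"
    by (intro measurable_Pair measurable_occupation)
  also have "count_space (occ N) \<Otimes>\<^sub>M count_space (occ N) = count_space (occ N \<times> occ N)"
    by (rule pair_measure_countable) auto
  finally have m: "(\<lambda>\<eta>. (\<eta> x, \<eta> y)) \<in> measurable (config_algebra N) (count_space (occ N \<times> occ N))" .
  have "(\<lambda>\<eta>. (\<lambda>(n, k). h n k) (\<eta> x, \<eta> y)) \<in> measurable (config_algebra N) M"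
    by (rule measurable_compose[OF m]) (use assms in auto)
  then show ?thesis by simp
qed


section \<open>Rates and weights\<close>

locale misanthrope =
  fixes N :: enat and b :: "nat \<Rightarrow> nat \<Rightarrow> real" and p :: "'s::countable \<Rightarrow> 's \<Rightarrow> real"
  assumes standing: "standing_assumptions N b p"
begin

lemma
  shows one_le_max: "1 \<le> N"
    and kernel_nonneg_all: "\<forall>x y. 0 \<le> p x y"
    and rate_nonneg_all: "\<forall>n\<in>occ N. \<forall>k\<in>occ N. 0 \<le> b n k"
    and rate_bounded: "\<exists>B. \<forall>n\<in>occ N. \<forall>k\<in>occ N. b n k \<le> B"
    and finite_range_all: "\<forall>x. finite {y. p x y + p y x > 0}"
    and total_rate_bounded: "bdd_above (range (\<lambda>x. \<Sum>\<^sub>\<infinity>y. p x y + p y x))"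
    and irreducible_kernel: "irreducible_kernel p"
    and rate_eq_0_iff_all: "\<forall>n\<in>occ N. \<forall>k\<in>occ N. b n k = 0 \<longleftrightarrow> n = 0 \<or> enat k = N"
    and rate_relation_all: "\<forall>i j. i + 1 \<in> occ N \<longrightarrow> j \<in> occ N \<longrightarrow> 1 \<le> j \<longrightarrow>
        b (i + 1) (j - 1) / b j i = (b 1 (j - 1) / b j 0) * (b (i + 1) 0 / b 1 i)"
  by (insert standing[unfolded standing_assumptions_def]) (elim conjE, assumption)+

lemma one_in_occ: "1 \<in> occ N"
  using one_le_max by (metis mem_Collect_eq occ_def one_enat_def)

lemma zero_ne_max: "enat 0 \<noteq> N"
  using one_in_occ Suc_in_occ_iff[of 0 N] by auto

lemma kernel_nonneg: "0 \<le> p x y"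
  using kernel_nonneg_all by blast

lemma rate_nonneg: "n \<in> occ N \<Longrightarrow> k \<in> occ N \<Longrightarrow> 0 \<le> b n k"
  using rate_nonneg_all by blast

lemma rate_eq_0_iff: "n \<in> occ N \<Longrightarrow> k \<in> occ N \<Longrightarrow> b n k = 0 \<longleftrightarrow> n = 0 \<or> enat k = N"
  using rate_eq_0_iff_all by blast

lemma rate_pos: "n \<in> occ N \<Longrightarrow> k \<in> occ N \<Longrightarrow> n \<noteq> 0 \<Longrightarrow> enat k \<noteq> N \<Longrightarrow> 0 < b n k"
  using rate_nonneg[of n k] rate_eq_0_iff[of n k] by linarith

lemma rate_bound:
  obtains B where "0 \<le> B" "\<And>n k. n \<in> occ N \<Longrightarrow> k \<in> occ N \<Longrightarrow> \<bar>b n k\<bar> \<le> B"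
proof -
  obtain B where B: "\<forall>n\<in>occ N. \<forall>k\<in>occ N. b n k \<le> B"
    using rate_bounded by blast
  have "0 \<le> B" using B rate_nonneg[of 0 0] zero_in_occ[of N] by (metis order_trans)
  then show thesis using that[of B] B rate_nonneg by simp
qed

lemma finite_range: "finite {y. p x y + p y x > 0}"
  using finite_range_all by blast

lemma irreducible: "(x, y) \<in> {(u, v). p u v > 0}\<^sup>*"
  using irreducible_kernel unfolding irreducible_kernel_def by blast

lemma weight_Suc: "weight b (Suc n) = weight b n * (b 1 n / b (Suc n) 0)"
  by (simp add: weight_def)

lemma weight_0: "weight b 0 = 1"
  by (simp add: weight_def)

lemma weight_pos: "k \<in> occ N \<Longrightarrow> 0 < weight b k"
proof (induction k)
  case (Suc k)
  then have k: "k \<in> occ N" "enat k \<noteq> N" by (auto simp: Suc_in_occ_iff)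
  have "0 < b 1 k" "0 < b (Suc k) 0"
    using rate_pos[OF one_in_occ k(1)] k rate_pos[OF Suc.prems zero_in_occ] zero_ne_max by auto
  then show ?case using Suc.IH[OF k(1)] by (simp add: weight_Suc)
qed (simp add: weight_0)

text \<open>
  Detailed balance for the weights: this is where the algebraic relation between the rates enters.
\<close>

lemma weight_exchange:
  assumes n: "Suc n \<in> occ N" and k: "Suc k \<in> occ N"
  shows "weight b (Suc n) * weight b k * b (Suc n) k = weight b n * weight b (Suc k) * b (Suc k) n"
proof -
  have n': "n \<in> occ N" "enat n \<noteq> N" and k': "k \<in> occ N" "enat k \<noteq> N"
    using n k by (auto simp: Suc_in_occ_iff)
  have pos: "0 < b 1 n" "0 < b (Suc n) 0" "0 < b 1 k" "0 < b (Suc k) 0" "0 < b (Suc k) n"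
    using n' k' n k zero_ne_max by (auto intro!: rate_pos one_in_occ zero_in_occ simp: one_in_occ[simplified])
  have "b (Suc n) k / b (Suc k) n = (b 1 k / b (Suc k) 0) * (b (Suc n) 0 / b 1 n)"
    using rate_relation_all[rule_format, of n "Suc k"] n k by simp
  then have "b (Suc n) k = b (Suc k) n * ((b 1 k / b (Suc k) 0) * (b (Suc n) 0 / b 1 n))"
    using pos by (simp add: field_simps)
  then show ?thesis using pos by (simp add: weight_Suc)
qed

end


section \<open>The product measure and resampling of a site\<close>

locale misanthrope_product = misanthrope N b p
  for N :: enat and b :: "nat \<Rightarrow> nat \<Rightarrow> real" and p :: "'s::countable \<Rightarrow> 's \<Rightarrow> real" +
  fixes l :: "'s \<Rightarrow> real"
  assumes parameters: "l \<in> parameters N b"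
begin

abbreviation \<mu> :: "('s \<Rightarrow> nat) measure" where
  "\<mu> \<equiv> product_measure N b l"

definition site_prob :: "'s \<Rightarrow> nat \<Rightarrow> real" where
  "site_prob x n = weight b n * l x ^ n / partition_function N b (l x)"

lemma l_nonneg: "0 \<le> l x"
  using parameters by (simp add: parameters_def)

text \<open>
  For unbounded occupation numbers this is the ratio test: the critical value is the limes
  inferior of the inverse ratios of successive weights.
\<close>

lemma summable_weight: "(\<lambda>k. weight b k * l x ^ k) summable_on occ N"
proof (cases "N = \<infinity>")
  case False
  then have "finite (occ N)" by (auto simp: occ_def)
  then show ?thesis by (rule summable_on_finite)
next
  case True
  then have W: "occ N = UNIV" by (auto simp: occ_def)
  have rpos: "0 < b (j + 1) 0 / b 1 j" for j
    using rate_pos[of "Suc j" 0] rate_pos[of 1 j] W True by (simp add: zero_enat_def)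
  have "ereal (l x) < liminf (\<lambda>j. ereal (b (j + 1) 0 / b 1 j))"
    using parameters True by (simp add: parameters_def critical_value_def)
  then obtain r where r: "l x < r" "ereal r < liminf (\<lambda>j. ereal (b (j + 1) 0 / b 1 j))"
    using ereal_dense2 by fastforce
  have "eventually (\<lambda>j. ereal r < ereal (b (j + 1) 0 / b 1 j)) sequentially"
    using less_LiminfD[OF r(2)] .
  then obtain K where K: "\<And>j. K \<le> j \<Longrightarrow> r < b (j + 1) 0 / b 1 j"
    unfolding eventually_sequentially by auto
  have r0: "0 < r" using r(1) l_nonneg[of x] by linarith
  have "summable (\<lambda>k. weight b k * l x ^ k)"
  proof (rule summable_ratio_test[where c = "l x / r" and N = K])
    show "l x / r < 1" using r r0 by simp
    fix n assume n: "K \<le> n"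
    have "b 1 n / b (Suc n) 0 \<le> 1 / r"
    proof -
      have "1 / (b (n + 1) 0 / b 1 n) \<le> 1 / r"
        using K[OF n] r0 by (intro divide_left_mono mult_pos_pos) linarith+
      then show ?thesis by simp
    qed
    then have "b 1 n / b (Suc n) 0 * (weight b n * l x ^ Suc n) \<le> 1 / r * (weight b n * l x ^ Suc n)"
      using weight_pos[of n] l_nonneg[of x] W by (intro mult_right_mono) (auto intro: mult_nonneg_nonneg)
    moreover have norm_eq: "norm (weight b k * l x ^ k) = weight b k * l x ^ k" for k
      using weight_pos[of k] l_nonneg[of x] W by (simp add: abs_mult)
    ultimately show "norm (weight b (Suc n) * l x ^ Suc n) \<le> l x / r * norm (weight b n * l x ^ n)"
      unfolding norm_eq by (simp add: weight_Suc algebra_simps)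
  qed
  moreover have "\<And>k. 0 \<le> weight b k * l x ^ k"
    using weight_pos l_nonneg W by (simp add: less_imp_le)
  ultimately show ?thesis
    unfolding W by (subst summable_on_UNIV_nonneg_real_iff) auto
qed

lemma partition_function_pos: "0 < partition_function N b (l x)"
proof -
  have "(\<Sum>k\<in>{0}. weight b k * l x ^ k) \<le> partition_function N b (l x)"
    unfolding partition_function_def
    by (rule finite_sum_le_infsum[OF summable_weight])
      (auto simp: zero_in_occ less_imp_le[OF weight_pos] l_nonneg)
  then show ?thesis by (simp add: weight_0)
qed

lemma site_prob_nonneg: "n \<in> occ N \<Longrightarrow> 0 \<le> site_prob x n"
  using weight_pos[of n] l_nonneg[of x] partition_function_pos[of x] by (simp add: site_prob_def)

lemma site_prob_pos: "n \<in> occ N \<Longrightarrow> 0 < l x \<Longrightarrow> 0 < site_prob x n"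
  using weight_pos[of n] partition_function_pos[of x] by (simp add: site_prob_def)

lemma summable_site_prob: "site_prob x summable_on occ N"
  unfolding site_prob_def[abs_def] divide_inverse
  by (intro summable_on_cmult_left summable_weight)

lemma sum_site_prob: "(\<Sum>\<^sub>\<infinity>n\<in>occ N. site_prob x n) = 1"
  using partition_function_pos[of x]
  by (simp add: site_prob_def[abs_def] divide_inverse infsum_cmult_left' flip: partition_function_def)

lemma marginal_eq: "marginal N b (l x) = point_measure (occ N) (\<lambda>n. ennreal (site_prob x n))"
  by (simp add: marginal_def site_prob_def)

lemma sets_marginal[measurable_cong]: "sets (marginal N b (l x)) = sets (count_space (occ N))"
  by (simp add: marginal_eq sets_point_measure)

lemma space_marginal: "space (marginal N b (l x)) = occ N"
  by (simp add: marginal_eq space_point_measure)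

lemma abs_summable_site_prob:
  assumes "\<And>n. n \<in> occ N \<Longrightarrow> \<bar>g n\<bar> \<le> B"
  shows "(\<lambda>n. norm (site_prob x n * g n)) summable_on occ N"
proof (rule summable_on_comparison_test)
  show "(\<lambda>n. site_prob x n * B) summable_on occ N"
    by (intro summable_on_cmult_left summable_site_prob)
qed (use assms site_prob_nonneg in \<open>auto simp: abs_mult intro!: mult_left_mono\<close>)

lemma integral_marginal:
  assumes "\<And>n. n \<in> occ N \<Longrightarrow> \<bar>g n\<bar> \<le> B"
  shows "(\<integral>n. g n \<partial>marginal N b (l x)) = (\<Sum>\<^sub>\<infinity>n\<in>occ N. site_prob x n * g n)"
proof -
  have "(\<integral>n. g n \<partial>marginal N b (l x)) = (\<integral>n. site_prob x n * g n \<partial>count_space (occ N))"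
    unfolding marginal_eq point_measure_def
    by (subst integral_density) (auto simp: AE_count_space site_prob_nonneg)
  also have "\<dots> = infsetsum (\<lambda>n. site_prob x n * g n) (occ N)"
    by (simp add: infsetsum_def)
  also have "\<dots> = (\<Sum>\<^sub>\<infinity>n\<in>occ N. site_prob x n * g n)"
    using abs_summable_site_prob[OF assms] by (intro infsetsum_infsum) (simp flip: abs_summable_equivalent)
  finally show ?thesis .
qed

lemma prob_space_marginal: "prob_space (marginal N b (l x))"
proof
  have "emeasure (marginal N b (l x)) (occ N) = (\<integral>\<^sup>+n. ennreal (site_prob x n) \<partial>count_space (occ N))"
    by (simp add: marginal_eq point_measure_def emeasure_density)
      (rule nn_integral_cong, simp)
  also have "\<dots> = ennreal (\<integral>n. site_prob x n \<partial>count_space (occ N))"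
    using abs_summable_site_prob[of "\<lambda>_. 1" 1 x] site_prob_nonneg
    by (intro nn_integral_eq_integral)
      (auto simp: AE_count_space abs_summable_equivalent abs_summable_on_def[symmetric] simp flip: real_norm_def)
  also have "(\<integral>n. site_prob x n \<partial>count_space (occ N)) = 1"
    using abs_summable_site_prob[of "\<lambda>_. 1" 1 x] sum_site_prob
    by (subst infsetsum_infsum[unfolded infsetsum_def]) (auto simp flip: abs_summable_equivalent)
  finally show "emeasure (marginal N b (l x)) (space (marginal N b (l x))) = 1"
    by (simp add: space_marginal)
qed

lemma prob_space_product: "prob_space \<mu>"
  unfolding product_measure_def by (intro prob_space_PiM prob_space_marginal)

lemma sets_product[measurable_cong]: "sets \<mu> = sets (config_algebra N)"
  unfolding product_measure_def config_algebra_def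
  by (intro sets_PiM_cong) (auto simp: sets_marginal)

lemma space_product: "space \<mu> = config N"
  using sets_eq_imp_space_eq[OF sets_product] by (simp add: space_config_algebra)

lemma integrable_observable: "observable N f \<Longrightarrow> integrable \<mu> f"
proof -
  interpret prob_space \<mu> by (rule prob_space_product)
  assume f: "observable N f"
  then obtain B where B: "0 \<le> B" "\<And>\<eta>. \<eta> \<in> config N \<Longrightarrow> \<bar>f \<eta>\<bar> \<le> B" using observable_bound by blast
  have "f \<in> borel_measurable \<mu>"
    unfolding measurable_cong_sets[OF sets_product refl] by (rule observable_measurable[OF f])
  then show "integrable \<mu> f"
    by (intro integrable_const_bound[of _ B]) (auto simp: space_product B)
qed

text \<open>
  Replacing the occupation number of one site by an independent copy does not change a product
  measure. Everything about the independence of sites that is needed later is an instance of this.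
\<close>

lemma
  assumes f: "observable N f"
  shows resample: "(\<integral>\<eta>. (\<Sum>\<^sub>\<infinity>n\<in>occ N. site_prob x n * f (\<eta>(x := n))) \<partial>\<mu>) = integral\<^sup>L \<mu> f"
    and observable_resample: "observable N (\<lambda>\<eta>. \<Sum>\<^sub>\<infinity>n\<in>occ N. site_prob x n * f (\<eta>(x := n)))"
proof -
  interpret Mu: prob_space \<mu> by (rule prob_space_product)
  interpret M: prob_space "marginal N b (l x)" by (rule prob_space_marginal)
  interpret pair_prob_space "marginal N b (l x)" \<mu> ..
  obtain B where B: "0 \<le> B" "\<And>\<eta>. \<eta> \<in> config N \<Longrightarrow> \<bar>f \<eta>\<bar> \<le> B" using observable_bound[OF f] by blast
  let ?P = "marginal N b (l x) \<Otimes>\<^sub>M \<mu>"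
  have sets_pair: "sets ?P = sets (count_space (occ N) \<Otimes>\<^sub>M config_algebra N)"
    by (intro sets_pair_measure_cong sets_marginal sets_product)
  have up0: "(\<lambda>(n, \<eta>). \<eta>(x := n)) \<in> measurable ?P (config_algebra N)"
    unfolding measurable_cong_sets[OF sets_pair refl] by (rule measurable_update)
  then have up: "(\<lambda>(n, \<eta>). \<eta>(x := n)) \<in> measurable ?P \<mu>"
    unfolding measurable_cong_sets[OF refl sets_product] .
  have fup: "(\<lambda>(n, \<eta>). f (\<eta>(x := n))) \<in> borel_measurable ?P"
    using measurable_compose[OF up0 observable_measurable[OF f]] by (simp add: split_beta')
  have "distr ?P \<mu> (\<lambda>(n, \<eta>). \<eta>(x := n)) = \<mu>"
    using distr_pair_PiM_eq_PiM[of UNIV "\<lambda>x. marginal N b (l x)" x] prob_space_marginal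
    by (simp add: product_measure_def)
  then have "integral\<^sup>L \<mu> f = integral\<^sup>L (distr ?P \<mu> (\<lambda>(n, \<eta>). \<eta>(x := n))) f" by simp
  also have "\<dots> = (\<integral>(n, \<eta>). f (\<eta>(x := n)) \<partial>?P)"
    using observable_measurable[OF f]
    by (subst integral_distr[OF up]) (simp_all add: split_beta' measurable_cong_sets[OF sets_product refl])
  also have "\<dots> = (\<integral>\<eta>. (\<integral>n. f (\<eta>(x := n)) \<partial>marginal N b (l x)) \<partial>\<mu>)"
    by (rule integral_snd[symmetric], rule integrable_const_bound[of _ B], rule AE_I2)
      (auto simp: fup space_pair_measure space_marginal space_product config_update B)
  also have "\<dots> = (\<integral>\<eta>. (\<Sum>\<^sub>\<infinity>n\<in>occ N. site_prob x n * f (\<eta>(x := n))) \<partial>\<mu>)"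
    by (rule Bochner_Integration.integral_cong[OF refl])
      (auto intro!: integral_marginal[where B=B] B config_update simp: space_product)
  finally show "(\<integral>\<eta>. (\<Sum>\<^sub>\<infinity>n\<in>occ N. site_prob x n * f (\<eta>(x := n))) \<partial>\<mu>) = integral\<^sup>L \<mu> f" by simp
  have "(\<lambda>\<eta>. \<integral>n. f (\<eta>(x := n)) \<partial>marginal N b (l x)) \<in> borel_measurable \<mu>"
    using measurable_pair_swap[OF fup] by (intro M.borel_measurable_lebesgue_integral) simp
  also have "?this \<longleftrightarrow> (\<lambda>\<eta>. \<Sum>\<^sub>\<infinity>n\<in>occ N. site_prob x n * f (\<eta>(x := n))) \<in> borel_measurable \<mu>"
    by (rule measurable_cong) (auto intro!: integral_marginal[where B=B] B config_update simp: space_product)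
  finally have m: "(\<lambda>\<eta>. \<Sum>\<^sub>\<infinity>n\<in>occ N. site_prob x n * f (\<eta>(x := n))) \<in> borel_measurable (config_algebra N)"
    unfolding measurable_cong_sets[OF sets_product refl] .
  show "observable N (\<lambda>\<eta>. \<Sum>\<^sub>\<infinity>n\<in>occ N. site_prob x n * f (\<eta>(x := n)))"
  proof (rule observableI[OF m, of B])
    fix \<eta> :: "'s \<Rightarrow> nat" assume \<eta>: "\<eta> \<in> config N"
    have s: "(\<lambda>n. norm (site_prob x n * f (\<eta>(x := n)))) summable_on occ N"
      by (rule abs_summable_site_prob[where B=B]) (auto intro!: B config_update \<eta>)
    have "\<bar>\<Sum>\<^sub>\<infinity>n\<in>occ N. site_prob x n * f (\<eta>(x := n))\<bar>
        \<le> (\<Sum>\<^sub>\<infinity>n\<in>occ N. norm (site_prob x n * f (\<eta>(x := n))))"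
      using norm_infsum_bound[OF s] by simp
    also have "\<dots> \<le> (\<Sum>\<^sub>\<infinity>n\<in>occ N. site_prob x n * B)"
      using s by (intro infsum_mono)
        (auto intro!: summable_on_cmult_left summable_site_prob mult_left_mono B config_update \<eta>
          site_prob_nonneg simp: abs_mult site_prob_nonneg)
    also have "\<dots> = B" by (simp add: infsum_cmult_left' sum_site_prob)
    finally show "\<bar>\<Sum>\<^sub>\<infinity>n\<in>occ N. site_prob x n * f (\<eta>(x := n))\<bar> \<le> B" .
  qed
qed

end


section \<open>Jumps and the exchange identity\<close>

text \<open>
  In contrast to \<^const>\<open>jump\<close>, this maps \<open>E\<close> to itself even if the jump has rate zero, so that it
  can be composed with functions that are only controlled on \<open>E\<close>.
\<close>

definition legal_jump :: "(nat \<Rightarrow> nat \<Rightarrow> real) \<Rightarrow> 's \<Rightarrow> 's \<Rightarrow> ('s \<Rightarrow> nat) \<Rightarrow> 's \<Rightarrow> nat" where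
  "legal_jump b x y \<eta> = (if b (\<eta> x) (\<eta> y) = 0 then \<eta> else jump \<eta> x y)"

lemma legal_jump_outside: "z \<noteq> x \<Longrightarrow> z \<noteq> y \<Longrightarrow> legal_jump b x y \<eta> z = \<eta> z"
  by (simp add: legal_jump_def jump_def)

context misanthrope
begin

lemma rate_nonzeroD:
  assumes "\<eta> \<in> config N" "b (\<eta> x) (\<eta> y) \<noteq> 0"
  shows "\<eta> x \<noteq> 0" "Suc (\<eta> y) \<in> occ N"
proof -
  have "\<eta> x \<in> occ N" "\<eta> y \<in> occ N" using assms(1) by (auto simp: config_def)
  then show "\<eta> x \<noteq> 0" "Suc (\<eta> y) \<in> occ N"
    using rate_eq_0_iff[of "\<eta> x" "\<eta> y"] assms(2) by (auto simp: Suc_in_occ_iff)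
qed

lemma legal_jump_self: "\<eta> \<in> config N \<Longrightarrow> legal_jump b x x \<eta> = \<eta>"
  using rate_nonzeroD(1)[of \<eta> x x] by (auto simp: legal_jump_def jump_def)

lemma legal_jump_eq:
  "x \<noteq> y \<Longrightarrow> legal_jump b x y \<eta> = (if b (\<eta> x) (\<eta> y) = 0 then \<eta> else \<eta>(x := \<eta> x - 1, y := Suc (\<eta> y)))"
  by (auto simp: legal_jump_def jump_def fun_eq_iff)

lemma legal_jump_config:
  assumes "\<eta> \<in> config N"
  shows "legal_jump b x y \<eta> \<in> config N"
proof (cases "x = y \<or> b (\<eta> x) (\<eta> y) = 0")
  case True
  then have "legal_jump b x y \<eta> = \<eta>" using legal_jump_self[OF assms] by (metis legal_jump_def)
  then show ?thesis using assms by simp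
next
  case False
  then have "\<eta>(x := \<eta> x - 1, y := Suc (\<eta> y)) \<in> config N"
    using assms rate_nonzeroD(2)[OF assms, of x y]
    by (intro config_update) (auto simp: config_def intro: occ_downward[of "\<eta> x"])
  then show ?thesis using False by (simp add: legal_jump_eq)
qed

lemma measurable_legal_jump:
  fixes x y :: 's
  shows "legal_jump b x y \<in> measurable (config_algebra N) (config_algebra N)"
proof -
  have "(\<lambda>\<eta> z. legal_jump b x y \<eta> z) \<in> measurable (config_algebra N) (PiM UNIV (\<lambda>_. count_space (occ N)))"
  proof (rule measurable_PiM_single')
    show "(\<lambda>\<eta>. legal_jump b x y \<eta> z) \<in> measurable (config_algebra N) (count_space (occ N))" for z
    proof (cases "x = y \<or> (z \<noteq> x \<and> z \<noteq> y)")
      case True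
      have "(\<lambda>\<eta>. legal_jump b x y \<eta> z) \<in> measurable (config_algebra N) (count_space (occ N)) \<longleftrightarrow>
          (\<lambda>\<eta>. \<eta> z) \<in> measurable (config_algebra N) (count_space (occ N))"
      proof (rule measurable_cong)
        fix \<eta> :: "'s \<Rightarrow> nat" assume "\<eta> \<in> space (config_algebra N)"
        then have "\<eta> \<in> config N" by (simp add: space_config_algebra)
        then show "legal_jump b x y \<eta> z = \<eta> z"
          using True legal_jump_self[of \<eta> x] legal_jump_outside[of z x y b \<eta>] by metis
      qed
      then show ?thesis by (rule iffD2[OF _ measurable_occupation])
    next
      case False
      then have xy: "x \<noteq> y" "z = x \<or> z = y" by auto
      define h where "h n k = (if b n k = 0 then (if z = x then n else k)
        else if z = x then n - 1 else Suc k)" for n k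
      have "(\<lambda>\<eta>. h (\<eta> x) (\<eta> y)) \<in> measurable (config_algebra N) (count_space (occ N))"
        by (rule measurable_two_sites)
          (use rate_eq_0_iff in \<open>auto simp: h_def Suc_in_occ_iff intro: occ_downward\<close>)
      also have "(\<lambda>\<eta>. h (\<eta> x) (\<eta> y)) = (\<lambda>\<eta>. legal_jump b x y \<eta> z)"
        using xy by (auto simp: h_def legal_jump_eq fun_eq_iff)
      finally show ?thesis .
    qed
  qed (use legal_jump_config[of _ x y] in \<open>auto simp: space_config_algebra config_def PiE_UNIV_domain\<close>)
  then show ?thesis by (simp flip: config_algebra_def)
qed

definition flux :: "'s \<Rightarrow> 's \<Rightarrow> (('s \<Rightarrow> nat) \<Rightarrow> real) \<Rightarrow> ('s \<Rightarrow> nat) \<Rightarrow> real" where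
  "flux x y f \<eta> = b (\<eta> x) (\<eta> y) * (f (legal_jump b x y \<eta>) - f \<eta>)"

lemma generator_eq_flux: "generator b p f \<eta> = (\<Sum>\<^sub>\<infinity>(x, y)\<in>UNIV. p x y * flux x y f \<eta>)"
  unfolding generator_def flux_def
  by (rule infsum_cong) (auto simp: legal_jump_def)

lemma observable_rate: "observable N (\<lambda>\<eta>. b (\<eta> x) (\<eta> y))"
proof -
  obtain B where B: "0 \<le> B" "\<And>n k. n \<in> occ N \<Longrightarrow> k \<in> occ N \<Longrightarrow> \<bar>b n k\<bar> \<le> B" using rate_bound by blast
  show ?thesis
    by (rule observableI[OF measurable_two_sites, where B = B]) (use B in \<open>auto simp: config_def\<close>)
qed

lemma observable_empty_rate: "observable N (\<lambda>\<eta>. b (\<eta> x) 0)"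
proof -
  obtain B where B: "0 \<le> B" "\<And>n k. n \<in> occ N \<Longrightarrow> k \<in> occ N \<Longrightarrow> \<bar>b n k\<bar> \<le> B" using rate_bound by blast
  have "(\<lambda>\<eta>. b (\<eta> x) 0) \<in> borel_measurable (config_algebra N)"
    by (rule measurable_two_sites[of N "\<lambda>n k. b n 0" borel x x]) simp
  then show ?thesis
    by (rule observableI[where B = B]) (auto simp: config_def zero_in_occ intro!: B)
qed

lemma observable_legal_jump:
  fixes x y :: 's
  shows "observable N f \<Longrightarrow> observable N (\<lambda>\<eta>. f (legal_jump b x y \<eta>))"
  by (rule observable_compose[OF _ measurable_legal_jump])

lemma observable_flux: "observable N f \<Longrightarrow> observable N (flux x y f)"
  unfolding flux_def[abs_def]
  by (intro observable_mult observable_diff observable_rate observable_legal_jump)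

text \<open>
  A jump changes two sites, so it can be decomposed into two changes of one site.
  The bound is uniform in the function, which allows domination along a sequence of
  functions with controlled variation.
\<close>

lemma flux_bound:
  obtains B where "0 \<le> B" "\<And>x y f \<eta>. bounded (f ` config N) \<Longrightarrow> \<eta> \<in> config N \<Longrightarrow>
    \<bar>flux x y f \<eta>\<bar> \<le> B * (variation N f x + variation N f y)"
proof -
  obtain B where B: "0 \<le> B" "\<And>n k. n \<in> occ N \<Longrightarrow> k \<in> occ N \<Longrightarrow> \<bar>b n k\<bar> \<le> B" using rate_bound by blast
  have "\<bar>flux x y f \<eta>\<bar> \<le> B * (variation N f x + variation N f y)"
    if f: "bounded (f ` config N)" and \<eta>: "\<eta> \<in> config N" for x y f \<eta>
  proof -
    have "\<bar>f (legal_jump b x y \<eta>) - f \<eta>\<bar> \<le> variation N f x + variation N f y"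
    proof (cases "x = y \<or> b (\<eta> x) (\<eta> y) = 0")
      case True
      then have "legal_jump b x y \<eta> = \<eta>" using legal_jump_self[OF \<eta>] by (metis legal_jump_def)
      then show ?thesis using variation_nonneg[OF f] by simp
    next
      case False
      let ?\<zeta> = "\<eta>(x := \<eta> x - 1)"
      have \<zeta>: "?\<zeta> \<in> config N"
        using \<eta> by (intro config_update) (auto simp: config_def intro: occ_downward[of "\<eta> x"])
      have J: "legal_jump b x y \<eta> = ?\<zeta>(y := Suc (\<eta> y))" using False by (simp add: legal_jump_eq)
      have "\<bar>f (legal_jump b x y \<eta>) - f ?\<zeta>\<bar> \<le> variation N f y"
        by (rule variation_upper[OF f legal_jump_config[OF \<eta>] \<zeta>]) (simp add: J)
      moreover have "\<bar>f ?\<zeta> - f \<eta>\<bar> \<le> variation N f x"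
        by (rule variation_upper[OF f \<zeta> \<eta>]) simp
      ultimately show ?thesis by linarith
    qed
    then show ?thesis
      unfolding flux_def abs_mult using \<eta> B by (intro mult_mono) (auto simp: config_def)
  qed
  with B(1) show thesis by (rule that)
qed

lemma summable_kernel: "(\<lambda>y. p x y + p y x) summable_on UNIV"
proof -
  have "(\<lambda>y. p x y + p y x) summable_on {y. p x y + p y x > 0}"
    by (rule summable_on_finite[OF finite_range])
  then show ?thesis
    by (rule summable_on_cong_neutral[THEN iffD1, rotated -1])
      (use kernel_nonneg in \<open>auto simp: add_nonneg_eq_0_iff less_le\<close>)
qed

lemma summable_weighted_kernel:
  assumes nn: "\<And>x. 0 \<le> v x" and v: "v summable_on UNIV"
  shows "(\<lambda>(x, y). p x y * (v x + v y)) summable_on UNIV"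
proof -
  obtain C where C: "\<And>x. (\<Sum>\<^sub>\<infinity>y. p x y + p y x) \<le> C"
    using total_rate_bounded by (auto simp: bdd_above_def)
  have C0: "0 \<le> (\<Sum>\<^sub>\<infinity>y. p x y + p y x)" for x
    by (intro infsum_nonneg add_nonneg_nonneg kernel_nonneg)
  have 1: "(\<lambda>(x, y). (p x y + p y x) * v x) summable_on UNIV \<times> UNIV"
  proof (rule summable_on_SigmaI)
    show "((\<lambda>y. case (x, y) of (x, y) \<Rightarrow> (p x y + p y x) * v x) has_sum (\<Sum>\<^sub>\<infinity>y. p x y + p y x) * v x) UNIV" for x
      using has_sum_cmult_left[OF has_sum_infsum[OF summable_kernel[of x]], of "v x"] by simp
    show "(\<lambda>x. (\<Sum>\<^sub>\<infinity>y. p x y + p y x) * v x) summable_on UNIV"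
      by (rule summable_on_comparison_test[where f = "\<lambda>x. C * v x"])
        (use nn C C0 in \<open>auto intro!: summable_on_cmult_right v mult_right_mono\<close>)
  qed (use nn kernel_nonneg in auto)
  have a: "(\<lambda>(x, y). p x y * v x) summable_on UNIV"
    by (rule summable_on_comparison_test[where f = "\<lambda>(x, y). (p x y + p y x) * v x"])
      (use 1 nn kernel_nonneg in \<open>auto intro!: mult_right_mono\<close>)
  have "(\<lambda>(x, y). p y x * v x) summable_on UNIV"
    by (rule summable_on_comparison_test[where f = "\<lambda>(x, y). (p x y + p y x) * v x"])
      (use 1 nn kernel_nonneg in \<open>auto intro!: mult_right_mono\<close>)
  then have "(\<lambda>z. (\<lambda>(x, y). p y x * v x) (prod.swap z)) summable_on UNIV"
    by (subst summable_on_reindex_bij_betw[where B = UNIV]) (auto simp: bij_betw_def)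
  then have "(\<lambda>(x, y). p x y * v y) summable_on UNIV"
    by (simp add: split_beta')
  from summable_on_add[OF a this] show ?thesis
    by (simp add: split_beta' algebra_simps)
qed

end

context misanthrope_product
begin

lemma resample_pair:
  assumes f: "observable N f" and xy: "x \<noteq> y"
  shows "integral\<^sup>L \<mu> f = (\<integral>\<eta>. (\<Sum>\<^sub>\<infinity>(n, k)\<in>occ N \<times> occ N.
    site_prob x n * site_prob y k * f (\<eta>(x := n, y := k))) \<partial>\<mu>)"
proof -
  obtain B where B: "0 \<le> B" "\<And>\<eta>. \<eta> \<in> config N \<Longrightarrow> \<bar>f \<eta>\<bar> \<le> B" using observable_bound[OF f] by blast
  have pointwise: "(\<Sum>\<^sub>\<infinity>n\<in>occ N. site_prob x n *
        (\<Sum>\<^sub>\<infinity>k\<in>occ N. site_prob y k * f (\<eta>(x := n, y := k))))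
      = (\<Sum>\<^sub>\<infinity>(n, k)\<in>occ N \<times> occ N. site_prob x n * site_prob y k * f (\<eta>(x := n, y := k)))"
    if \<eta>: "\<eta> \<in> config N" for \<eta>
  proof -
    have "(\<lambda>(n, k). site_prob x n * (site_prob y k * B)) summable_on occ N \<times> occ N"
    proof (rule summable_on_SigmaI)
      show "((\<lambda>k. case (n, k) of (n, k) \<Rightarrow> site_prob x n * (site_prob y k * B))
          has_sum site_prob x n * (1 * B)) (occ N)" for n
        using has_sum_cmult_right[OF has_sum_cmult_left[OF has_sum_infsum[OF summable_site_prob[of y]], of B],
            of "site_prob x n"] by (simp add: sum_site_prob)
      show "(\<lambda>n. site_prob x n * (1 * B)) summable_on occ N"
        by (intro summable_on_cmult_left summable_site_prob)
    qed (use B site_prob_nonneg in auto)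
    then have "(\<lambda>z. norm (case z of (n, k) \<Rightarrow> site_prob x n * site_prob y k * f (\<eta>(x := n, y := k))))
        summable_on occ N \<times> occ N"
      by (rule summable_on_comparison_test)
        (auto simp: abs_mult site_prob_nonneg mult.assoc intro!: mult_left_mono B config_update \<eta>)
    then have "(\<lambda>(n, k). site_prob x n * site_prob y k * f (\<eta>(x := n, y := k))) summable_on occ N \<times> occ N"
      by (rule abs_summable_summable)
    from infsum_Sigma'_banach[OF this] show ?thesis
      by (simp add: infsum_cmult_right' mult.assoc)
  qed
  have "integral\<^sup>L \<mu> f = (\<integral>\<eta>. (\<Sum>\<^sub>\<infinity>k\<in>occ N. site_prob y k * f (\<eta>(y := k))) \<partial>\<mu>)"
    using resample[OF f, of y] by simp
  also have "\<dots> = (\<integral>\<eta>. (\<Sum>\<^sub>\<infinity>n\<in>occ N. site_prob x n *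
      (\<Sum>\<^sub>\<infinity>k\<in>occ N. site_prob y k * f (\<eta>(x := n, y := k)))) \<partial>\<mu>)"
    using resample[OF observable_resample[OF f, of y], of x] by simp
  also have "\<dots> = (\<integral>\<eta>. (\<Sum>\<^sub>\<infinity>(n, k)\<in>occ N \<times> occ N.
    site_prob x n * site_prob y k * f (\<eta>(x := n, y := k))) \<partial>\<mu>)"
    by (rule Bochner_Integration.integral_cong[OF refl]) (use pointwise in \<open>auto simp: space_product\<close>)
  finally show ?thesis .
qed

lemma site_prob_exchange:
  assumes "Suc n \<in> occ N" "Suc k \<in> occ N"
  shows "l y * (site_prob x (Suc n) * site_prob y k * b (Suc n) k)
    = l x * (site_prob x n * site_prob y (Suc k) * b (Suc k) n)"
proof -
  let ?c = "l x ^ Suc n * l y ^ Suc k / (partition_function N b (l x) * partition_function N b (l y))"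
  have "l y * (site_prob x (Suc n) * site_prob y k * b (Suc n) k)
      = (weight b (Suc n) * weight b k * b (Suc n) k) * ?c"
    by (simp add: site_prob_def)
  also have "\<dots> = (weight b n * weight b (Suc k) * b (Suc k) n) * ?c"
    by (simp only: weight_exchange[OF assms])
  also have "\<dots> = l x * (site_prob x n * site_prob y (Suc k) * b (Suc k) n)"
    by (simp add: site_prob_def)
  finally show ?thesis .
qed

text \<open>
  The jump from \<open>x\<close> to \<open>y\<close> maps the pairs \<open>(n + 1, k)\<close> of occupation numbers bijectively to
  the pairs \<open>(n, k + 1)\<close>, and the weights of corresponding pairs match by detailed balance. The
  pairs that are left out have rate zero. The factors \<open>l x\<close> and \<open>l y\<close> are kept on both sides in order to
  include the case in which one of them is zero.
\<close>

lemma jump_exchange: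
  assumes g: "observable N g" and xy: "x \<noteq> y"
  shows "l y * (\<integral>\<eta>. b (\<eta> x) (\<eta> y) * g (legal_jump b x y \<eta>) \<partial>\<mu>)
    = l x * (\<integral>\<eta>. b (\<eta> y) (\<eta> x) * g \<eta> \<partial>\<mu>)"
proof -
  let ?F = "\<lambda>\<eta>. b (\<eta> x) (\<eta> y) * g (legal_jump b x y \<eta>)"
  let ?G = "\<lambda>\<eta>. b (\<eta> y) (\<eta> x) * g \<eta>"
  let ?W = "occ N \<times> occ N"
  let ?I = "{z. Suc (fst z) \<in> occ N \<and> Suc (snd z) \<in> occ N}"
  have F: "observable N ?F" and G: "observable N ?G"
    by (intro observable_mult observable_rate observable_legal_jump g)+
  have pointwise: "l y * (\<Sum>\<^sub>\<infinity>(n, k)\<in>?W. site_prob x n * site_prob y k * ?F (\<eta>(x := n, y := k)))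
      = l x * (\<Sum>\<^sub>\<infinity>(n, k)\<in>?W. site_prob x n * site_prob y k * ?G (\<eta>(x := n, y := k)))" for \<eta>
  proof -
    let ?f = "\<lambda>(n, k). site_prob x n * site_prob y k * ?F (\<eta>(x := n, y := k))"
    let ?g = "\<lambda>(n, k). site_prob x n * site_prob y k * ?G (\<eta>(x := n, y := k))"
    let ?i = "\<lambda>(n::nat, k::nat). (Suc n, k)" and ?j = "\<lambda>(n::nat, k::nat). (n, Suc k)"
    have "(\<Sum>\<^sub>\<infinity>z\<in>?W. ?f z) = (\<Sum>\<^sub>\<infinity>z\<in>?i ` ?I. ?f z)"
    proof (rule infsum_cong_neutral)
      fix z assume z: "z \<in> ?W - ?i ` ?I"
      obtain n k where nk: "z = (n, k)" by fastforce
      have "b n k = 0"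
      proof (rule ccontr)
        assume "b n k \<noteq> 0"
        then have "n \<noteq> 0" "Suc k \<in> occ N"
          using rate_eq_0_iff[of n k] z nk by (auto simp: Suc_in_occ_iff)
        then have "z = ?i (n - 1, k)" "(n - 1, k) \<in> ?I" using nk z by auto
        then show False using z by blast
      qed
      then show "?f z = 0" using nk xy by simp
    qed (auto simp: Suc_in_occ_iff)
    also have "\<dots> = (\<Sum>\<^sub>\<infinity>z\<in>?I. ?f (?i z))"
      by (subst infsum_reindex) (auto simp: inj_on_def o_def)
    finally have 1: "(\<Sum>\<^sub>\<infinity>z\<in>?W. ?f z) = (\<Sum>\<^sub>\<infinity>z\<in>?I. ?f (?i z))" .
    have "(\<Sum>\<^sub>\<infinity>z\<in>?W. ?g z) = (\<Sum>\<^sub>\<infinity>z\<in>?j ` ?I. ?g z)"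
    proof (rule infsum_cong_neutral)
      fix z assume z: "z \<in> ?W - ?j ` ?I"
      obtain n k where nk: "z = (n, k)" by fastforce
      have "b k n = 0"
      proof (rule ccontr)
        assume "b k n \<noteq> 0"
        then have "k \<noteq> 0" "Suc n \<in> occ N"
          using rate_eq_0_iff[of k n] z nk by (auto simp: Suc_in_occ_iff)
        then have "z = ?j (n, k - 1)" "(n, k - 1) \<in> ?I" using nk z by auto
        then show False using z by blast
      qed
      then show "?g z = 0" using nk xy by simp
    qed (auto simp: Suc_in_occ_iff)
    also have "\<dots> = (\<Sum>\<^sub>\<infinity>z\<in>?I. ?g (?j z))"
      by (subst infsum_reindex) (auto simp: inj_on_def o_def)
    finally have 2: "(\<Sum>\<^sub>\<infinity>z\<in>?W. ?g z) = (\<Sum>\<^sub>\<infinity>z\<in>?I. ?g (?j z))" .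
    have "l y * ?f (?i z) = l x * ?g (?j z)" if "z \<in> ?I" for z
    proof -
      obtain n k where nk: "z = (n, k)" by fastforce
      have I: "Suc n \<in> occ N" "Suc k \<in> occ N" using that nk by auto
      then have "b (Suc n) k \<noteq> 0" using rate_eq_0_iff[of "Suc n" k] by (auto simp: Suc_in_occ_iff)
      then have "legal_jump b x y (\<eta>(x := Suc n, y := k)) = \<eta>(x := n, y := Suc k)"
        using xy by (simp add: legal_jump_eq fun_eq_iff)
      then show ?thesis
        using site_prob_exchange[OF I, of y x] xy nk by (simp add: mult.assoc[symmetric])
    qed
    then have "(\<Sum>\<^sub>\<infinity>z\<in>?I. l y * ?f (?i z)) = (\<Sum>\<^sub>\<infinity>z\<in>?I. l x * ?g (?j z))"
      by (rule infsum_cong)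
    then show ?thesis unfolding 1 2 by (simp add: infsum_cmult_right')
  qed
  have "l y * integral\<^sup>L \<mu> ?F = (\<integral>\<eta>. l y * (\<Sum>\<^sub>\<infinity>(n, k)\<in>?W. site_prob x n * site_prob y k * ?F (\<eta>(x := n, y := k))) \<partial>\<mu>)"
    unfolding resample_pair[OF F xy] by simp
  also have "\<dots> = (\<integral>\<eta>. l x * (\<Sum>\<^sub>\<infinity>(n, k)\<in>?W. site_prob x n * site_prob y k * ?G (\<eta>(x := n, y := k))) \<partial>\<mu>)"
    by (simp only: pointwise)
  also have "\<dots> = l x * integral\<^sup>L \<mu> ?G"
    unfolding resample_pair[OF G xy] by simp
  finally show ?thesis .
qed

end


section \<open>The generator on functions of finitely many sites\<close>

definition depends_on :: "enat \<Rightarrow> 's set \<Rightarrow> (('s \<Rightarrow> nat) \<Rightarrow> real) \<Rightarrow> bool" where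
  "depends_on N \<Lambda> f \<longleftrightarrow> (\<forall>\<eta>\<in>config N. \<forall>\<zeta>\<in>config N. (\<forall>x\<in>\<Lambda>. \<eta> x = \<zeta> x) \<longrightarrow> f \<eta> = f \<zeta>)"

lemma depends_onD:
  "depends_on N \<Lambda> f \<Longrightarrow> \<eta> \<in> config N \<Longrightarrow> \<zeta> \<in> config N \<Longrightarrow> (\<And>x. x \<in> \<Lambda> \<Longrightarrow> \<eta> x = \<zeta> x) \<Longrightarrow> f \<eta> = f \<zeta>"
  unfolding depends_on_def by blast

context misanthrope
begin

definition neighbours :: "'s \<Rightarrow> 's set" where
  "neighbours x = {y. y \<noteq> x \<and> 0 < p x y + p y x}"

text \<open>
  Both orientations of a bond are included because the exchange identity reverses them.
\<close>

definition bonds :: "'s set \<Rightarrow> ('s \<times> 's) set" where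
  "bonds \<Lambda> = {(x, y). (x \<in> \<Lambda> \<or> y \<in> \<Lambda>) \<and> y \<in> neighbours x}"

lemma neighbours_sym: "y \<in> neighbours x \<longleftrightarrow> x \<in> neighbours y"
  by (auto simp: neighbours_def add.commute)

lemma finite_neighbours: "finite (neighbours x)"
  by (rule finite_subset[OF _ finite_range[of x]]) (auto simp: neighbours_def)

lemma finite_bonds: "finite \<Lambda> \<Longrightarrow> finite (bonds \<Lambda>)"
  by (rule finite_subset[of _ "(\<Union>x\<in>\<Lambda>. {x} \<times> neighbours x) \<union> (\<Union>x\<in>\<Lambda>. neighbours x \<times> {x})"])
    (auto simp: bonds_def finite_neighbours neighbours_sym)

lemma bonds_swap: "(\<Sum>(x, y)\<in>bonds \<Lambda>. h y x) = (\<Sum>(x, y)\<in>bonds \<Lambda>. (h x y :: real))"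
proof -
  have sym: "prod.swap ` bonds \<Lambda> = bonds \<Lambda>"
    by (force simp: bonds_def neighbours_sym)
  have "(\<Sum>(x, y)\<in>bonds \<Lambda>. h x y) = (\<Sum>(x, y)\<in>prod.swap ` bonds \<Lambda>. h x y)"
    by (simp only: sym)
  also have "\<dots> = (\<Sum>(x, y)\<in>bonds \<Lambda>. h y x)"
    by (subst sum.reindex) (auto simp: split_beta' intro!: sum.cong)
  finally show ?thesis by simp
qed

lemma kernel_off_neighbours: "x \<noteq> y \<Longrightarrow> y \<notin> neighbours x \<Longrightarrow> p x y = 0 \<and> p y x = 0"
  using kernel_nonneg[of x y] kernel_nonneg[of y x] by (auto simp: neighbours_def)

end

context misanthrope_product
begin

definition mean_flux :: "'s \<Rightarrow> 's \<Rightarrow> (('s \<Rightarrow> nat) \<Rightarrow> real) \<Rightarrow> real" where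
  "mean_flux x y f = (\<integral>\<eta>. flux x y f \<eta> \<partial>\<mu>)"

definition total_flux :: "(('s \<Rightarrow> nat) \<Rightarrow> real) \<Rightarrow> real" where
  "total_flux f = (\<Sum>\<^sub>\<infinity>(x, y)\<in>UNIV. p x y * mean_flux x y f)"

definition net_flow :: "'s \<Rightarrow> 's \<Rightarrow> real" where
  "net_flow x y = l y * p y x - l x * p x y"

definition rate_moment :: "'s \<Rightarrow> 's \<Rightarrow> (('s \<Rightarrow> nat) \<Rightarrow> real) \<Rightarrow> real" where
  "rate_moment x y f = (\<integral>\<eta>. b (\<eta> x) (\<eta> y) * f \<eta> \<partial>\<mu>)"

lemma net_flow_antisym: "net_flow x y = - net_flow y x"
  by (simp add: net_flow_def)

lemma net_flow_off_neighbours: "y \<notin> neighbours x \<Longrightarrow> net_flow x y = 0"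
  using kernel_off_neighbours[of x y] by (cases "x = y") (auto simp: net_flow_def)

text \<open>
  The balance equation says that the flow is free of divergence. The term \<open>p x x\<close> occurs
  on both sides of the equation and cancels.
\<close>

lemma balance_equation_iff: "balance_equation p l \<longleftrightarrow> (\<forall>x. (\<Sum>y\<in>neighbours x. net_flow x y) = 0)"
proof -
  have diff: "(\<Sum>\<^sub>\<infinity>x. l x * p x y) - l y * (\<Sum>\<^sub>\<infinity>x. p y x) = (\<Sum>x\<in>neighbours y. net_flow y x)" for y
  proof -
    have zero: "p x y = 0" "p y x = 0" if "x \<notin> insert y (neighbours y)" for x
      using that kernel_off_neighbours[of y x] by auto
    have "(\<Sum>\<^sub>\<infinity>x. l x * p x y) = (\<Sum>\<^sub>\<infinity>x\<in>insert y (neighbours y). l x * p x y)"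
      by (rule infsum_cong_neutral) (auto simp: zero)
    moreover have "(\<Sum>\<^sub>\<infinity>x. p y x) = (\<Sum>\<^sub>\<infinity>x\<in>insert y (neighbours y). p y x)"
      by (rule infsum_cong_neutral) (auto simp: zero)
    moreover have "y \<notin> neighbours y" by (simp add: neighbours_def)
    ultimately show ?thesis
      by (simp add: finite_neighbours net_flow_def sum_subtractf sum_distrib_left algebra_simps)
  qed
  show ?thesis
    unfolding balance_equation_def diff[symmetric] by simp
qed

lemma mean_flux_self: "mean_flux x x f = 0"
proof -
  have "mean_flux x x f = (\<integral>\<eta>. 0 \<partial>\<mu>)"
    unfolding mean_flux_def
    by (rule Bochner_Integration.integral_cong[OF refl])
      (simp add: flux_def space_product legal_jump_self)
  then show ?thesis by simp
qed

lemma mean_flux_shift: "mean_flux x y (\<lambda>\<eta>. f \<eta> - c) = mean_flux x y f"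
  by (simp add: mean_flux_def flux_def[abs_def])

lemma mean_flux_outside:
  assumes f: "depends_on N \<Lambda> f" and "x \<notin> \<Lambda>" "y \<notin> \<Lambda>"
  shows "mean_flux x y f = 0"
proof -
  have "mean_flux x y f = (\<integral>\<eta>. 0 \<partial>\<mu>)"
    unfolding mean_flux_def
  proof (rule Bochner_Integration.integral_cong[OF refl])
    fix \<eta> assume "\<eta> \<in> space \<mu>"
    then have \<eta>: "\<eta> \<in> config N" by (simp add: space_product)
    have "f (legal_jump b x y \<eta>) = f \<eta>"
      by (rule depends_onD[OF f legal_jump_config[OF \<eta>] \<eta>]) (use assms legal_jump_outside in metis)
    then show "flux x y f \<eta> = 0" by (simp add: flux_def)
  qed
  then show ?thesis by simp
qed

text \<open>
  The exchange identity removes the jump from the argument of \<open>f\<close>. The price is that the two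
  resulting terms cannot in general be summed separately over all bonds, which is why functions of finitely many
  sites come first.
\<close>

lemma mean_flux_eq_moments:
  assumes f: "observable N f" and xy: "x \<noteq> y" and pos: "0 < l y"
  shows "mean_flux x y f = l x / l y * rate_moment y x f - rate_moment x y f"
proof -
  have "mean_flux x y f = (\<integral>\<eta>. b (\<eta> x) (\<eta> y) * f (legal_jump b x y \<eta>) - b (\<eta> x) (\<eta> y) * f \<eta> \<partial>\<mu>)"
    by (simp add: mean_flux_def flux_def[abs_def] right_diff_distrib)
  also have "\<dots> = (\<integral>\<eta>. b (\<eta> x) (\<eta> y) * f (legal_jump b x y \<eta>) \<partial>\<mu>) - rate_moment x y f"
    unfolding rate_moment_def
    by (intro Bochner_Integration.integral_diff integrable_observable observable_mult
        observable_rate observable_legal_jump f)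
  also have "(\<integral>\<eta>. b (\<eta> x) (\<eta> y) * f (legal_jump b x y \<eta>) \<partial>\<mu>) = l x / l y * rate_moment y x f"
    using jump_exchange[OF f xy] pos by (simp add: rate_moment_def field_simps)
  finally show ?thesis .
qed

lemma integral_bound:
  assumes f: "observable N f" and B: "\<And>\<eta>. \<eta> \<in> config N \<Longrightarrow> \<bar>f \<eta>\<bar> \<le> B"
  shows "\<bar>integral\<^sup>L \<mu> f\<bar> \<le> B" "(\<integral>\<eta>. \<bar>f \<eta>\<bar> \<partial>\<mu>) \<le> B"
proof -
  interpret prob_space \<mu> by (rule prob_space_product)
  have "(\<integral>\<eta>. \<bar>f \<eta>\<bar> \<partial>\<mu>) \<le> (\<integral>\<eta>. B \<partial>\<mu>)"
    using integrable_observable[OF f] B by (intro integral_mono) (auto simp: space_product)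
  then show "(\<integral>\<eta>. \<bar>f \<eta>\<bar> \<partial>\<mu>) \<le> B" by (simp add: prob_space)
  then show "\<bar>integral\<^sup>L \<mu> f\<bar> \<le> B" using integral_abs_bound[of \<mu> f] by linarith
qed

text \<open>
  Fubini for the sum over all bonds and the integral, dominated by means of the summable variations of \<open>f\<close>.
\<close>

lemma integral_generator:
  assumes f: "f \<in> test_functions N"
  shows "integral\<^sup>L \<mu> (generator b p f) = total_flux f"
    and "(\<lambda>(x, y). p x y * mean_flux x y f) summable_on UNIV"
proof -
  interpret Mu: prob_space \<mu> by (rule prob_space_product)
  interpret C: sigma_finite_measure "count_space (UNIV :: ('s \<times> 's) set)"
    by (rule sigma_finite_measure_count_space_countable) auto
  interpret pair_sigma_finite "count_space (UNIV :: ('s \<times> 's) set)" \<mu> ..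
  have bf: "bounded (f ` config N)" and vf: "variation N f summable_on UNIV"
    using f by (auto simp: test_functions_def)
  have of: "observable N f" by (rule observable_test_function[OF f])
  obtain B where B: "0 \<le> B" "\<And>x y f \<eta>. bounded (f ` config N) \<Longrightarrow> \<eta> \<in> config N \<Longrightarrow>
    \<bar>flux x y f \<eta>\<bar> \<le> B * (variation N f x + variation N f y)" using flux_bound by blast
  define bnd where "bnd = (\<lambda>(x, y). B * (p x y * (variation N f x + variation N f y)))"
  define h where "h z \<eta> = (case z of (x, y) \<Rightarrow> p x y * flux x y f \<eta>)" for z \<eta>
  have bnd: "bnd summable_on UNIV"
    using summable_on_cmult_right[OF summable_weighted_kernel[OF variation_nonneg[OF bf] vf], of B]
    by (simp add: bnd_def split_beta')
  have obs: "observable N (h z)" for z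
    unfolding h_def[abs_def] by (cases z) (auto intro!: observable_mult observable_const observable_flux of)
  have h_bnd: "\<bar>h z \<eta>\<bar> \<le> bnd z" if "\<eta> \<in> config N" for z \<eta>
    using mult_left_mono[OF B(2)[OF bf that] kernel_nonneg, of "fst z" "snd z" "fst z" "snd z"] kernel_nonneg
    by (simp add: h_def bnd_def split_beta' abs_mult algebra_simps)
  have bnd0: "0 \<le> bnd z" for z using h_bnd[OF zero_config, of z] by linarith
  have int_bnd: "integrable (count_space UNIV) bnd"
    using bnd bnd0 by (simp add: abs_summable_on_def[symmetric] flip: abs_summable_equivalent)
  have sum_h: "(\<lambda>z. norm (h z \<eta>)) summable_on UNIV" if "\<eta> \<in> config N" for \<eta>
    by (rule summable_on_comparison_test[OF bnd]) (use h_bnd[OF that] in auto)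
  have int_h: "\<bar>integral\<^sup>L \<mu> (h z)\<bar> \<le> bnd z" "(\<integral>\<eta>. \<bar>h z \<eta>\<bar> \<partial>\<mu>) \<le> bnd z" for z
    using integral_bound[OF obs h_bnd] by auto
  have norm_int: "(\<lambda>z. norm (integral\<^sup>L \<mu> (h z))) summable_on UNIV"
    by (rule summable_on_comparison_test[OF bnd]) (use int_h in auto)
  have meas: "case_prod h \<in> borel_measurable (count_space UNIV \<Otimes>\<^sub>M \<mu>)"
    by (rule measurable_pair_measure_countable1)
      (use observable_measurable[OF obs] in \<open>auto simp: measurable_cong_sets[OF sets_product refl]\<close>)
  have int_pair: "integrable (count_space UNIV \<Otimes>\<^sub>M \<mu>) (case_prod h)"
  proof (rule Fubini_integrable[OF meas])
    show "integrable (count_space UNIV) (\<lambda>z. \<integral>\<eta>. norm (case (z, \<eta>) of (z, \<eta>) \<Rightarrow> h z \<eta>) \<partial>\<mu>)"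
      by (rule Bochner_Integration.integrable_bound[OF int_bnd]) (use int_h bnd0 in auto)
  qed (use integrable_observable[OF obs] in auto)
  have mean: "integral\<^sup>L \<mu> (h z) = (case z of (x, y) \<Rightarrow> p x y * mean_flux x y f)" for z
    by (cases z) (simp add: h_def[abs_def] mean_flux_def)
  have "integral\<^sup>L \<mu> (generator b p f) = (\<integral>\<eta>. (\<integral>z. h z \<eta> \<partial>count_space UNIV) \<partial>\<mu>)"
  proof (rule Bochner_Integration.integral_cong[OF refl])
    fix \<eta> assume "\<eta> \<in> space \<mu>"
    then have \<eta>: "\<eta> \<in> config N" by (simp add: space_product)
    have "(\<integral>z. h z \<eta> \<partial>count_space UNIV) = (\<Sum>\<^sub>\<infinity>z. h z \<eta>)"
      using sum_h[OF \<eta>] by (subst infsetsum_infsum[unfolded infsetsum_def]) (auto simp flip: abs_summable_equivalent)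
    then show "generator b p f \<eta> = (\<integral>z. h z \<eta> \<partial>count_space UNIV)"
      by (simp add: generator_eq_flux h_def)
  qed
  also have "\<dots> = (\<integral>z. integral\<^sup>L \<mu> (h z) \<partial>count_space UNIV)"
    unfolding integral_snd[OF int_pair] integral_fst[OF int_pair] ..
  also have "\<dots> = (\<Sum>\<^sub>\<infinity>z. integral\<^sup>L \<mu> (h z))"
    using norm_int by (subst infsetsum_infsum[unfolded infsetsum_def]) (auto simp flip: abs_summable_equivalent)
  finally show "integral\<^sup>L \<mu> (generator b p f) = total_flux f"
    by (simp add: mean total_flux_def)
  show "(\<lambda>(x, y). p x y * mean_flux x y f) summable_on UNIV"
    using abs_summable_summable[OF norm_int] by (simp add: mean)
qed

lemma invariant_iff_total_flux:
  "\<mu> \<in> invariant_measures N b p \<longleftrightarrow> (\<forall>f\<in>test_functions N. total_flux f = 0)"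
  unfolding invariant_measures_def
  using prob_space_product sets_product integral_generator(1) by auto

text \<open>
  Renaming \<open>x\<close> and \<open>y\<close> in the gain terms collects, for each oriented bond, the coefficient
  \<open>l y * p y x / l x - p x y\<close>.
\<close>

lemma total_flux_local:
  assumes f: "observable N f" and dep: "depends_on N \<Lambda> f" and fin: "finite \<Lambda>" and pos: "\<And>x. 0 < l x"
  shows "total_flux f = (\<Sum>(x, y)\<in>bonds \<Lambda>. net_flow x y / l x * rate_moment x y f)"
proof -
  have zero: "p x y * mean_flux x y f = 0" if "(x, y) \<notin> bonds \<Lambda>" for x y
    using that mean_flux_outside[OF dep, of x y] mean_flux_self[of x f] kernel_off_neighbours[of x y]
    by (cases "x = y") (auto simp: bonds_def)
  have "total_flux f = (\<Sum>\<^sub>\<infinity>(x, y)\<in>bonds \<Lambda>. p x y * mean_flux x y f)"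
    unfolding total_flux_def by (rule infsum_cong_neutral) (use zero in auto)
  also have "\<dots> = (\<Sum>(x, y)\<in>bonds \<Lambda>. p x y * mean_flux x y f)"
    by (rule infsum_finite[OF finite_bonds[OF fin]])
  also have "\<dots> = (\<Sum>(x, y)\<in>bonds \<Lambda>. p x y * (l x / l y) * rate_moment y x f - p x y * rate_moment x y f)"
  proof (rule sum.cong[OF refl], clarify)
    fix x y assume "(x, y) \<in> bonds \<Lambda>"
    then have "x \<noteq> y" by (auto simp: bonds_def neighbours_def)
    show "p x y * mean_flux x y f = p x y * (l x / l y) * rate_moment y x f - p x y * rate_moment x y f"
      unfolding mean_flux_eq_moments[OF f \<open>x \<noteq> y\<close> pos] by (simp add: right_diff_distrib)
  qed
  also have "\<dots> = (\<Sum>(x, y)\<in>bonds \<Lambda>. p x y * (l x / l y) * rate_moment y x f)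
      - (\<Sum>(x, y)\<in>bonds \<Lambda>. p x y * rate_moment x y f)"
    by (simp add: split_beta' sum_subtractf)
  also have "(\<Sum>(x, y)\<in>bonds \<Lambda>. p x y * (l x / l y) * rate_moment y x f)
      = (\<Sum>(x, y)\<in>bonds \<Lambda>. p y x * (l y / l x) * rate_moment x y f)"
    by (rule bonds_swap[where h = "\<lambda>x y. p y x * (l y / l x) * rate_moment x y f"])
  also have "\<dots> - (\<Sum>(x, y)\<in>bonds \<Lambda>. p x y * rate_moment x y f)
      = (\<Sum>(x, y)\<in>bonds \<Lambda>. net_flow x y / l x * rate_moment x y f)"
    unfolding sum_subtractf[symmetric]
    using pos by (intro sum.cong) (auto simp: net_flow_def field_simps less_imp_neq[symmetric])
  finally show ?thesis .
qed

lemma empty_rate_independent: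
  assumes f: "observable N f" and dep: "depends_on N \<Lambda> f" and x: "x \<notin> \<Lambda>" and mean: "integral\<^sup>L \<mu> f = 0"
  shows "(\<integral>\<eta>. b (\<eta> x) 0 * f \<eta> \<partial>\<mu>) = 0"
proof -
  have obs: "observable N (\<lambda>\<eta>. b (\<eta> x) 0)" by (rule observable_empty_rate)
  have "(\<integral>\<eta>. b (\<eta> x) 0 * f \<eta> \<partial>\<mu>)
      = (\<integral>\<eta>. (\<Sum>\<^sub>\<infinity>n\<in>occ N. site_prob x n * (b ((\<eta>(x := n)) x) 0 * f (\<eta>(x := n)))) \<partial>\<mu>)"
    by (rule resample[OF observable_mult[OF obs f], symmetric])
  also have "\<dots> = (\<integral>\<eta>. (\<Sum>\<^sub>\<infinity>n\<in>occ N. site_prob x n * b n 0) * f \<eta> \<partial>\<mu>)"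
  proof (rule Bochner_Integration.integral_cong[OF refl])
    fix \<eta> assume "\<eta> \<in> space \<mu>"
    then have \<eta>: "\<eta> \<in> config N" by (simp add: space_product)
    have "(\<Sum>\<^sub>\<infinity>n\<in>occ N. site_prob x n * (b ((\<eta>(x := n)) x) 0 * f (\<eta>(x := n))))
        = (\<Sum>\<^sub>\<infinity>n\<in>occ N. site_prob x n * b n 0 * f \<eta>)"
    proof (rule infsum_cong)
      fix n assume "n \<in> occ N"
      then have "f (\<eta>(x := n)) = f \<eta>"
        using x \<eta> by (intro depends_onD[OF dep] config_update) auto
      then show "site_prob x n * (b ((\<eta>(x := n)) x) 0 * f (\<eta>(x := n))) = site_prob x n * b n 0 * f \<eta>"
        by simp
    qed
    then show "(\<Sum>\<^sub>\<infinity>n\<in>occ N. site_prob x n * (b ((\<eta>(x := n)) x) 0 * f (\<eta>(x := n))))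
        = (\<Sum>\<^sub>\<infinity>n\<in>occ N. site_prob x n * b n 0) * f \<eta>"
      by (simp add: infsum_cmult_left')
  qed
  also have "\<dots> = 0" using mean by simp
  finally show ?thesis .
qed

text \<open>
  A site outside \<open>\<Lambda>\<close> contributes nothing since its rate is independent of \<open>f\<close>,
  which has mean zero, and for a site in
  \<open>\<Lambda>\<close> all its bonds are present, so that the divergence of the flow factors out.
\<close>

lemma balance_kills_one_site_rates:
  assumes f: "observable N f" and dep: "depends_on N \<Lambda> f" and fin: "finite \<Lambda>"
    and mean: "integral\<^sup>L \<mu> f = 0" and bal: "balance_equation p l"
  shows "(\<Sum>(x, y)\<in>bonds \<Lambda>. net_flow x y / l x * (\<integral>\<eta>. b (\<eta> x) 0 * f \<eta> \<partial>\<mu>)) = 0"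
proof -
  let ?h = "\<lambda>x y. net_flow x y / l x * (\<integral>\<eta>. b (\<eta> x) 0 * f \<eta> \<partial>\<mu>)"
  have "(\<Sum>(x, y)\<in>bonds \<Lambda>. ?h x y) = (\<Sum>(x, y)\<in>Sigma \<Lambda> neighbours. ?h x y)"
  proof (rule sum.mono_neutral_right[OF finite_bonds[OF fin]])
    show "\<forall>z\<in>bonds \<Lambda> - Sigma \<Lambda> neighbours. (case z of (x, y) \<Rightarrow> ?h x y) = 0"
    proof
      fix z assume z: "z \<in> bonds \<Lambda> - Sigma \<Lambda> neighbours"
      obtain x y where xy: "z = (x, y)" by fastforce
      with z have "x \<notin> \<Lambda>" by (auto simp: bonds_def)
      from empty_rate_independent[OF f dep this mean] show "(case z of (x, y) \<Rightarrow> ?h x y) = 0"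
        by (simp add: xy)
    qed
  qed (auto simp: bonds_def)
  also have "\<dots> = (\<Sum>x\<in>\<Lambda>. \<Sum>y\<in>neighbours x. ?h x y)"
    by (rule sum.Sigma[symmetric]) (use fin finite_neighbours in auto)
  also have "\<dots> = (\<Sum>x\<in>\<Lambda>. (\<Sum>y\<in>neighbours x. net_flow x y) * (inverse (l x) * (\<integral>\<eta>. b (\<eta> x) 0 * f \<eta> \<partial>\<mu>)))"
    by (simp add: sum_distrib_right divide_inverse mult.assoc)
  also have "\<dots> = 0" using bal by (simp add: balance_equation_iff)
  finally show ?thesis .
qed

end

text \<open>
  Discreteness of the occupation numbers makes such a function locally constant.
\<close>

lemma two_site_test_function:
  assumes B: "\<And>n k. \<bar>h n k\<bar> \<le> B"
  shows "(\<lambda>\<eta>. h (\<eta> u) (\<eta> v)) \<in> test_functions N"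
proof -
  let ?f = "\<lambda>\<eta>. h (\<eta> u) (\<eta> v)"
  have bd: "bounded (?f ` config N)" using B by (auto simp: bounded_iff)
  have cont: "continuous_on (config N) ?f"
    unfolding continuous_on_def
  proof
    fix \<eta> :: "'a \<Rightarrow> nat"
    let ?U = "((\<lambda>\<zeta>. \<zeta> u) -` {\<eta> u}) \<inter> ((\<lambda>\<zeta>. \<zeta> v) -` {\<eta> v}) :: ('a \<Rightarrow> nat) set"
    have "open ?U"
      by (intro open_Int open_vimage discrete_topology_class.open_discrete continuous_on_product_coordinates)
    then have "eventually (\<lambda>\<zeta>. ?f \<zeta> = ?f \<eta>) (at \<eta> within config N)"
      unfolding eventually_at_topological by (intro exI[of _ ?U]) auto
    then show "(?f \<longlongrightarrow> ?f \<eta>) (at \<eta> within config N)" by (rule tendsto_eventually)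
  qed
  have "variation N ?f i = 0" if "i \<notin> {u, v}" for i
  proof -
    have "variation N ?f i \<le> 0"
      by (rule variation_least) (use that in auto)
    then show ?thesis using variation_nonneg[OF bd, of i] by linarith
  qed
  then have "variation N ?f summable_on UNIV \<longleftrightarrow> variation N ?f summable_on {u, v}"
    by (intro summable_on_cong_neutral) auto
  then have "variation N ?f summable_on UNIV" by simp
  with bd cont show ?thesis by (simp add: test_functions_def)
qed


section \<open>Approximation by functions of finitely many sites\<close>

definition truncation :: "nat \<Rightarrow> ('s::countable \<Rightarrow> nat) \<Rightarrow> 's \<Rightarrow> nat" where
  "truncation n \<eta> = (\<lambda>x. if to_nat x < n then \<eta> x else 0)"

lemma truncation_config: "\<eta> \<in> config N \<Longrightarrow> truncation n \<eta> \<in> config N"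
  by (simp add: config_def truncation_def zero_in_occ)

lemma truncation_tendsto: "(\<lambda>n. truncation n \<eta>) \<longlonglongrightarrow> \<eta>"
proof -
  have "((\<lambda>n. truncation n \<eta> x) \<longlongrightarrow> \<eta> x) sequentially" for x
  proof (rule tendsto_eventually)
    show "eventually (\<lambda>n. truncation n \<eta> x = \<eta> x) sequentially"
      using eventually_gt_at_top[of "to_nat x"] by eventually_elim (simp add: truncation_def)
  qed
  then have "limitin (product_topology (\<lambda>_. euclidean) UNIV) (\<lambda>n. truncation n \<eta>) \<eta> sequentially"
    by (simp add: limitin_componentwise)
  then show ?thesis by (simp add: euclidean_product_topology)
qed

lemma measurable_truncation:
  "truncation n \<in> measurable (config_algebra N) (config_algebra N :: ('s::countable \<Rightarrow> nat) measure)"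
proof -
  have "(\<lambda>\<eta> x. truncation n \<eta> x) \<in> measurable (config_algebra N) (PiM UNIV (\<lambda>_::'s. count_space (occ N)))"
  proof (rule measurable_PiM_single')
    show "(\<lambda>\<eta>. truncation n \<eta> x) \<in> measurable (config_algebra N) (count_space (occ N))" for x :: 's
      unfolding truncation_def by (cases "to_nat x < n") (auto simp: zero_in_occ measurable_occupation)
  qed (auto simp: space_config_algebra config_def PiE_UNIV_domain truncation_def zero_in_occ)
  then show ?thesis by (simp flip: config_algebra_def)
qed

lemma depends_on_truncation: "depends_on N {x. to_nat x < n} (\<lambda>\<eta>. f (truncation n \<eta>))"
  unfolding depends_on_def
proof (intro ballI impI)
  fix \<eta> \<zeta> :: "'a \<Rightarrow> nat" assume "\<forall>x\<in>{x. to_nat x < n}. \<eta> x = \<zeta> x"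
  then have "truncation n \<eta> = truncation n \<zeta>" by (auto simp: truncation_def)
  then show "f (truncation n \<eta>) = f (truncation n \<zeta>)" by simp
qed

lemma finite_truncation_sites: "finite {x::'s::countable. to_nat x < n}"
  by (rule finite_subset[of _ "(from_nat :: nat \<Rightarrow> 's) ` {..<n}"]) (auto intro: rev_image_eqI)

lemma bounded_truncation:
  assumes "bounded (f ` config N)"
  shows "bounded ((\<lambda>\<eta>. f (truncation n \<eta>)) ` config N)"
  by (rule bounded_subset[OF assms]) (auto simp: truncation_config)

text \<open>
  This makes the bound on the flux of \<open>f\<close> a common bound for all its truncations.
\<close>

lemma variation_truncation_le:
  assumes f: "bounded (f ` config N)"
  shows "variation N (\<lambda>\<eta>. f (truncation n \<eta>)) i \<le> variation N f i"
proof (rule variation_least)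
  fix \<eta> \<zeta> :: "'a \<Rightarrow> nat"
  assume "\<eta> \<in> config N" "\<zeta> \<in> config N" "\<And>j. j \<noteq> i \<Longrightarrow> \<eta> j = \<zeta> j"
  then show "\<bar>f (truncation n \<eta>) - f (truncation n \<zeta>)\<bar> \<le> variation N f i"
    by (intro variation_upper[OF f] truncation_config) (auto simp: truncation_def)
qed

context misanthrope_product
begin

text \<open>
  The truncations of \<open>f\<close> converge pointwise by continuity. Dominated convergence is applied twice,
  to the integral over configurations and to the sum over bonds.
\<close>

lemma total_flux_local_dense:
  assumes f: "f \<in> test_functions N"
    and loc: "\<And>g \<Lambda>. observable N g \<Longrightarrow> depends_on N \<Lambda> g \<Longrightarrow> finite \<Lambda> \<Longrightarrow> total_flux g = 0"
  shows "total_flux f = 0"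
proof -
  interpret Mu: prob_space \<mu> by (rule prob_space_product)
  have bf: "bounded (f ` config N)" and vf: "variation N f summable_on UNIV" and cf: "continuous_on (config N) f"
    using f by (auto simp: test_functions_def)
  have of: "observable N f" by (rule observable_test_function[OF f])
  define g where "g n \<eta> = f (truncation n \<eta>)" for n \<eta>
  have og: "observable N (g n)" for n
    unfolding g_def[abs_def] by (rule observable_compose[OF of measurable_truncation])
  have bg: "bounded (g n ` config N)" for n
    unfolding g_def[abs_def] by (rule bounded_truncation[OF bf])
  obtain B where B: "0 \<le> B" "\<And>x y f \<eta>. bounded (f ` config N) \<Longrightarrow> \<eta> \<in> config N \<Longrightarrow>
    \<bar>flux x y f \<eta>\<bar> \<le> B * (variation N f x + variation N f y)" using flux_bound by blast
  have flux_g: "\<bar>flux x y (g n) \<eta>\<bar> \<le> B * (variation N f x + variation N f y)" if "\<eta> \<in> config N" for x y n \<eta>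
  proof -
    have "variation N (g n) z \<le> variation N f z" for z
      unfolding g_def[abs_def] by (rule variation_truncation_le[OF bf])
    then have "B * (variation N (g n) x + variation N (g n) y) \<le> B * (variation N f x + variation N f y)"
      using B(1) by (intro mult_left_mono add_mono) auto
    with B(2)[OF bg that, of x y n] show ?thesis by linarith
  qed
  have g_tendsto: "(\<lambda>n. g n \<eta>) \<longlonglongrightarrow> f \<eta>" if \<eta>: "\<eta> \<in> config N" for \<eta>
    unfolding g_def
    by (rule continuous_on_tendsto_compose[OF cf truncation_tendsto \<eta>])
      (simp add: truncation_config \<eta>)
  have mean_tendsto: "(\<lambda>n. mean_flux x y (g n)) \<longlonglongrightarrow> mean_flux x y f" for x y
    unfolding mean_flux_def
  proof (rule integral_dominated_convergence[where w = "\<lambda>_. B * (variation N f x + variation N f y)"])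
    show "AE \<eta> in \<mu>. (\<lambda>n. flux x y (g n) \<eta>) \<longlonglongrightarrow> flux x y f \<eta>"
      unfolding flux_def
      by (intro AE_I2 tendsto_intros g_tendsto) (auto simp: space_product legal_jump_config)
    show "AE \<eta> in \<mu>. norm (flux x y (g n) \<eta>) \<le> B * (variation N f x + variation N f y)" for n
      by (intro AE_I2) (use flux_g in \<open>auto simp: space_product\<close>)
  qed (use observable_measurable[OF observable_flux] of og in
      \<open>auto simp: measurable_cong_sets[OF sets_product refl]\<close>)
  define bnd where "bnd = (\<lambda>(x, y). B * (p x y * (variation N f x + variation N f y)))"
  have bnd: "bnd summable_on UNIV"
    using summable_on_cmult_right[OF summable_weighted_kernel[OF variation_nonneg[OF bf] vf], of B]
    by (simp add: bnd_def split_beta')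
  have g_bnd: "\<bar>p x y * mean_flux x y (g n)\<bar> \<le> bnd (x, y)" for x y n
  proof -
    have "\<bar>mean_flux x y (g n)\<bar> \<le> B * (variation N f x + variation N f y)"
      unfolding mean_flux_def by (rule integral_bound[OF observable_flux[OF og] flux_g])
    from mult_left_mono[OF this kernel_nonneg[of x y]] kernel_nonneg[of x y] show ?thesis
      by (simp add: bnd_def abs_mult algebra_simps)
  qed
  have bnd0: "0 \<le> bnd z" for z using g_bnd[of "fst z" "snd z" 0] by (cases z) auto
  define s where "s n z = (case z of (x, y) \<Rightarrow> p x y * mean_flux x y (g n))" for n z
  define s' where "s' z = (case z of (x, y) \<Rightarrow> p x y * mean_flux x y f)" for z
  have count: "(\<Sum>\<^sub>\<infinity>z. r z) = (\<integral>z. r z \<partial>count_space UNIV)"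
    if "(\<lambda>z. norm (r z)) summable_on UNIV" for r :: "'s \<times> 's \<Rightarrow> real"
    using that by (subst infsetsum_infsum[unfolded infsetsum_def]) (auto simp flip: abs_summable_equivalent)
  have s_tendsto: "(\<lambda>n. s n z) \<longlonglongrightarrow> s' z" for z
    unfolding s_def s'_def by (cases z) (simp add: tendsto_mult[OF tendsto_const mean_tendsto])
  have s_bnd: "\<bar>s n z\<bar> \<le> bnd z" for n z
    unfolding s_def by (cases z) (use g_bnd in auto)
  have s'_bnd: "\<bar>s' z\<bar> \<le> bnd z" for z
    by (rule LIMSEQ_le_const2[OF tendsto_rabs[OF s_tendsto]]) (use s_bnd in auto)
  have sums: "(\<lambda>z. norm (s n z)) summable_on UNIV" "(\<lambda>z. norm (s' z)) summable_on UNIV" for n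
    by (rule summable_on_comparison_test[OF bnd], use s_bnd s'_bnd in auto)+
  have "(\<lambda>n. \<integral>z. s n z \<partial>count_space UNIV) \<longlonglongrightarrow> (\<integral>z. s' z \<partial>count_space UNIV)"
  proof (rule integral_dominated_convergence[where w = bnd])
    show "integrable (count_space UNIV) bnd"
      using bnd bnd0 by (simp add: abs_summable_on_def[symmetric] flip: abs_summable_equivalent)
  qed (use s_tendsto s_bnd in auto)
  moreover have "(\<integral>z. s n z \<partial>count_space UNIV) = 0" for n
  proof -
    have "total_flux (g n) = 0"
      using loc[OF og _ finite_truncation_sites] depends_on_truncation[of N n f] by (simp add: g_def[abs_def])
    then show ?thesis using count[OF sums(1)[of n]] by (simp add: total_flux_def s_def)
  qed
  ultimately have "(\<integral>z. s' z \<partial>count_space UNIV) = 0"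
    by (simp add: LIMSEQ_const_iff)
  then show ?thesis using count[OF sums(2)] by (simp add: total_flux_def s'_def)
qed


section \<open>The three types of balance\<close>

lemma total_flux_shift: "total_flux (\<lambda>\<eta>. f \<eta> - c) = total_flux f"
  by (simp add: total_flux_def mean_flux_shift)

lemma resample_vacant:
  assumes f: "observable N f" and zero: "l x = 0"
  shows "integral\<^sup>L \<mu> f = (\<integral>\<eta>. f (\<eta>(x := 0)) \<partial>\<mu>)"
proof -
  have prob: "site_prob x n = (if n = 0 then 1 else 0)" for n
  proof -
    have "partition_function N b (l x) = (\<Sum>\<^sub>\<infinity>k\<in>{0}. weight b k * l x ^ k)"
      unfolding partition_function_def by (rule infsum_cong_neutral) (auto simp: zero zero_in_occ)
    then show ?thesis by (simp add: site_prob_def weight_0 zero power_0_left)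
  qed
  have "(\<Sum>\<^sub>\<infinity>n\<in>occ N. site_prob x n * f (\<eta>(x := n))) = f (\<eta>(x := 0))" for \<eta>
  proof -
    have "(\<Sum>\<^sub>\<infinity>n\<in>occ N. site_prob x n * f (\<eta>(x := n))) = (\<Sum>\<^sub>\<infinity>n\<in>{0}. site_prob x n * f (\<eta>(x := n)))"
      by (rule infsum_cong_neutral) (auto simp: prob zero_in_occ)
    then show ?thesis by (simp add: prob)
  qed
  with resample[OF f, of x] show ?thesis by simp
qed

text \<open>
  Conditioning on the event \<open>\<eta> x = m\<close>.
\<close>

lemma resample_occupation:
  assumes f: "observable N f" and m: "m \<in> occ N"
    and vanish: "\<And>\<eta>. \<eta> \<in> config N \<Longrightarrow> \<eta> x \<noteq> m \<Longrightarrow> f \<eta> = 0"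
  shows "integral\<^sup>L \<mu> f = site_prob x m * (\<integral>\<eta>. f (\<eta>(x := m)) \<partial>\<mu>)"
proof -
  have "(\<integral>\<eta>. (\<Sum>\<^sub>\<infinity>n\<in>occ N. site_prob x n * f (\<eta>(x := n))) \<partial>\<mu>)
      = (\<integral>\<eta>. site_prob x m * f (\<eta>(x := m)) \<partial>\<mu>)"
  proof (rule Bochner_Integration.integral_cong[OF refl])
    fix \<eta> assume "\<eta> \<in> space \<mu>"
    then have \<eta>: "\<eta> \<in> config N" by (simp add: space_product)
    have "(\<Sum>\<^sub>\<infinity>n\<in>occ N. site_prob x n * f (\<eta>(x := n))) = (\<Sum>\<^sub>\<infinity>n\<in>{m}. site_prob x n * f (\<eta>(x := n)))"
      by (rule infsum_cong_neutral) (auto simp: m intro!: vanish config_update \<eta>)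
    then show "(\<Sum>\<^sub>\<infinity>n\<in>occ N. site_prob x n * f (\<eta>(x := n))) = site_prob x m * f (\<eta>(x := m))" by simp
  qed
  with resample[OF f, of x] show ?thesis by simp
qed

definition empty_rate :: "'s \<Rightarrow> real" where
  "empty_rate x = (\<integral>\<eta>. b (\<eta> x) 0 \<partial>\<mu>)"

lemma empty_rate_nonneg: "0 \<le> empty_rate x"
  unfolding empty_rate_def
  by (rule Bochner_Integration.integral_nonneg) (auto simp: space_product config_def intro!: rate_nonneg zero_in_occ)

lemma empty_rate_pos:
  assumes "0 < l x"
  shows "0 < empty_rate x"
proof -
  interpret prob_space \<mu> by (rule prob_space_product)
  obtain B where B: "0 \<le> B" "\<And>n k. n \<in> occ N \<Longrightarrow> k \<in> occ N \<Longrightarrow> \<bar>b n k\<bar> \<le> B" using rate_bound by blast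
  let ?S = "\<Sum>\<^sub>\<infinity>n\<in>occ N. site_prob x n * b n 0"
  have "empty_rate x = (\<integral>\<eta>. ?S \<partial>\<mu>)"
    using resample[OF observable_empty_rate, of x x] by (simp add: empty_rate_def)
  then have "empty_rate x = ?S" by (simp add: prob_space)
  moreover have "(\<Sum>n\<in>{1}. site_prob x n * b n 0) \<le> ?S"
  proof (rule finite_sum_le_infsum)
    show "(\<lambda>n. site_prob x n * b n 0) summable_on occ N"
      by (intro abs_summable_summable[OF abs_summable_site_prob[where B = B]] B zero_in_occ)
  qed (use one_in_occ in \<open>auto intro!: mult_nonneg_nonneg site_prob_nonneg rate_nonneg zero_in_occ\<close>)
  moreover have "0 < site_prob x 1 * b 1 0"
    by (intro mult_pos_pos site_prob_pos assms one_in_occ rate_pos zero_in_occ zero_ne_max) simp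
  ultimately show ?thesis by simp
qed

lemma type_a_moment:
  assumes "type_a N b"
  shows "rate_moment x y f = (\<integral>\<eta>. b (\<eta> x) 0 * f \<eta> \<partial>\<mu>)"
  unfolding rate_moment_def
  by (rule Bochner_Integration.integral_cong[OF refl])
    (use assms in \<open>auto simp: space_product config_def type_a_def\<close>)

lemma type_b_moment:
  assumes "type_b N b p l" "observable N f"
  shows "rate_moment x y f - rate_moment y x f = (\<integral>\<eta>. b (\<eta> x) 0 * f \<eta> \<partial>\<mu>) - (\<integral>\<eta>. b (\<eta> y) 0 * f \<eta> \<partial>\<mu>)"
proof -
  have int: "integrable \<mu> (\<lambda>\<eta>. b (\<eta> x) (\<eta> y) * f \<eta>)" "integrable \<mu> (\<lambda>\<eta>. b (\<eta> x) 0 * f \<eta>)" for x y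
    by (intro integrable_observable observable_mult observable_rate observable_empty_rate assms)+
  have "rate_moment x y f - rate_moment y x f = (\<integral>\<eta>. b (\<eta> x) (\<eta> y) * f \<eta> - b (\<eta> y) (\<eta> x) * f \<eta> \<partial>\<mu>)"
    unfolding rate_moment_def by (rule Bochner_Integration.integral_diff[symmetric]) (rule int)+
  also have "\<dots> = (\<integral>\<eta>. b (\<eta> x) 0 * f \<eta> - b (\<eta> y) 0 * f \<eta> \<partial>\<mu>)"
  proof (rule Bochner_Integration.integral_cong[OF refl])
    fix \<eta> assume "\<eta> \<in> space \<mu>"
    then have "\<eta> x \<in> occ N" "\<eta> y \<in> occ N" by (auto simp: space_product config_def)
    then have "b (\<eta> x) (\<eta> y) - b (\<eta> y) (\<eta> x) = b (\<eta> x) 0 - b (\<eta> y) 0"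
      using assms(1) by (simp add: type_b_def)
    then show "b (\<eta> x) (\<eta> y) * f \<eta> - b (\<eta> y) (\<eta> x) * f \<eta> = b (\<eta> x) 0 * f \<eta> - b (\<eta> y) 0 * f \<eta>"
      by (simp flip: left_diff_distrib)
  qed
  also have "\<dots> = (\<integral>\<eta>. b (\<eta> x) 0 * f \<eta> \<partial>\<mu>) - (\<integral>\<eta>. b (\<eta> y) 0 * f \<eta> \<partial>\<mu>)"
    by (rule Bochner_Integration.integral_diff) (rule int)+
  finally show ?thesis .
qed

text \<open>
  Subtracting the mean of \<open>f\<close> changes no increment, and makes the one-site rates of the sites that
  \<open>f\<close> does not depend on harmless.
\<close>

lemma total_flux_eq_0:
  assumes bal: "balance_equation p l" and type: "type_a N b \<or> type_b N b p l \<or> type_c p l"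
    and pos: "\<And>x. 0 < l x"
    and f: "observable N f" and dep: "depends_on N \<Lambda> f" and fin: "finite \<Lambda>"
  shows "total_flux f = 0"
proof -
  define g where "g \<eta> = f \<eta> - integral\<^sup>L \<mu> f" for \<eta>
  interpret Mu: prob_space \<mu> by (rule prob_space_product)
  have g: "observable N g" unfolding g_def[abs_def] by (intro observable_diff f observable_const)
  have dep_g: "depends_on N \<Lambda> g" using dep unfolding depends_on_def g_def by metis
  have mean: "integral\<^sup>L \<mu> g = 0"
    unfolding g_def[abs_def] using integrable_observable[OF f] by (simp add: Mu.prob_space)
  define e where "e x = (\<integral>\<eta>. b (\<eta> x) 0 * g \<eta> \<partial>\<mu>)" for x
  have e: "(\<Sum>(x, y)\<in>bonds \<Lambda>. net_flow x y / l x * e x) = 0"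
    unfolding e_def by (rule balance_kills_one_site_rates[OF g dep_g fin mean bal])
  have "total_flux f = total_flux g"
    unfolding g_def[abs_def] by (rule total_flux_shift[symmetric])
  also have "\<dots> = (\<Sum>(x, y)\<in>bonds \<Lambda>. net_flow x y / l x * rate_moment x y g)"
    by (rule total_flux_local[OF g dep_g fin pos])
  also have "\<dots> = 0"
    using type
  proof (elim disjE)
    assume "type_a N b"
    then show ?thesis using e by (simp add: type_a_moment e_def)
  next
    assume tb: "type_b N b p l"
    let ?d = "\<lambda>x y. net_flow x y / l x" and ?R = "\<lambda>x y. rate_moment x y g"
    have anti: "?d y x = - ?d x y" for x y
    proof (cases "net_flow x y = 0")
      case True
      then show ?thesis using net_flow_antisym[of x y] by simp
    next
      case False
      then have "l x = l y" using tb by (auto simp: type_b_def net_flow_def)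
      then show ?thesis using net_flow_antisym[of x y] by simp
    qed
    \<comment> \<open>As \<open>?d\<close> is antisymmetric, only the antisymmetric part of \<open>h\<close> contributes.\<close>
    have half: "2 * (\<Sum>(x, y)\<in>bonds \<Lambda>. ?d x y * h x y) = (\<Sum>(x, y)\<in>bonds \<Lambda>. ?d x y * (h x y - h y x))"
      for h :: "'s \<Rightarrow> 's \<Rightarrow> real"
    proof -
      have "(\<Sum>(x, y)\<in>bonds \<Lambda>. ?d x y * h x y) = (\<Sum>(x, y)\<in>bonds \<Lambda>. ?d y x * h y x)"
        by (rule bonds_swap[symmetric])
      also have "\<dots> = - (\<Sum>(x, y)\<in>bonds \<Lambda>. ?d x y * h y x)"
      proof -
        have "?d y x * h y x = - (?d x y * h y x)" for x y by (subst anti) simp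
        then show ?thesis by (simp add: split_beta' sum_negf del: times_divide_eq_left)
      qed
      finally show ?thesis
        by (simp add: split_beta' right_diff_distrib sum_subtractf)
    qed
    have "2 * (\<Sum>(x, y)\<in>bonds \<Lambda>. ?d x y * ?R x y) = (\<Sum>(x, y)\<in>bonds \<Lambda>. ?d x y * (e x - e y))"
      unfolding half e_def type_b_moment[OF tb g] ..
    also have "\<dots> = 2 * (\<Sum>(x, y)\<in>bonds \<Lambda>. ?d x y * e x)"
      by (rule half[symmetric])
    finally show ?thesis using e by simp
  next
    assume "type_c p l"
    then have "net_flow x y = 0" for x y unfolding type_c_def net_flow_def by (metis diff_self)
    then show ?thesis by simp
  qed
  finally show ?thesis .
qed


section \<open>Vacant sites\<close>

lemma mean_flux_vacant:
  assumes f: "observable N f" and zero: "l x = 0"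
  shows "mean_flux x y f = 0"
proof -
  have "mean_flux x y f = (\<integral>\<eta>. flux x y f (\<eta>(x := 0)) \<partial>\<mu>)"
    unfolding mean_flux_def by (rule resample_vacant[OF observable_flux[OF f] zero])
  also have "\<dots> = (\<integral>\<eta>. 0 \<partial>\<mu>)"
  proof (rule Bochner_Integration.integral_cong[OF refl])
    fix \<eta> assume "\<eta> \<in> space \<mu>"
    then have "(\<eta>(x := 0)) y \<in> occ N" by (auto simp: space_product config_def zero_in_occ)
    then have "b ((\<eta>(x := 0)) x) ((\<eta>(x := 0)) y) = 0"
      using rate_eq_0_iff[OF zero_in_occ] by simp
    then show "flux x y f (\<eta>(x := 0)) = 0" by (simp add: flux_def)
  qed
  finally show ?thesis by simp
qed

text \<open>
  Site \<open>u\<close> is almost surely empty and can only gain particles. In the stationary equation for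
  the indicator of \<open>\<eta> u = 0\<close> all terms therefore have the same sign, so each of them vanishes.
\<close>

lemma vacancy_spreads:
  assumes inv: "\<mu> \<in> invariant_measures N b p" and zero: "l u = 0" and edge: "0 < p y u"
  shows "l y = 0"
proof -
  let ?f = "\<lambda>\<eta>. if \<eta> u = 0 then 1 else (0::real)"
  have test: "?f \<in> test_functions N"
    using two_site_test_function[of "\<lambda>n k. if n = 0 then 1 else 0" 1 u u N] by simp
  have obs: "observable N ?f" by (rule observable_test_function[OF test])
  have dep: "depends_on N {u} ?f" by (simp add: depends_on_def)
  have into: "mean_flux y u ?f = - empty_rate y" if "y \<noteq> u" for y
  proof -
    have "mean_flux y u ?f = (\<integral>\<eta>. flux y u ?f (\<eta>(u := 0)) \<partial>\<mu>)"
      unfolding mean_flux_def by (rule resample_vacant[OF observable_flux[OF obs] zero])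
    also have "\<dots> = (\<integral>\<eta>. - b (\<eta> y) 0 \<partial>\<mu>)"
      by (rule Bochner_Integration.integral_cong[OF refl]) (use that in \<open>simp add: flux_def legal_jump_eq\<close>)
    finally show ?thesis by (simp add: empty_rate_def)
  qed
  have nonpos: "p x y * mean_flux x y ?f \<le> 0" for x y
  proof (cases "x = y \<or> x = u \<or> y \<noteq> u")
    case True
    then have "mean_flux x y ?f = 0"
      using mean_flux_self mean_flux_vacant[OF obs zero] mean_flux_outside[OF dep, of x y] by auto
    then show ?thesis by simp
  next
    case False
    then have "mean_flux x y ?f = - empty_rate x" using into by blast
    then show ?thesis using kernel_nonneg[of x y] empty_rate_nonneg[of x] by simp
  qed
  have "total_flux ?f = 0" using inv test by (simp add: invariant_iff_total_flux)
  then have tot: "(\<Sum>\<^sub>\<infinity>z. - (case z of (x, y) \<Rightarrow> p x y * mean_flux x y ?f)) = 0"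
    unfolding infsum_uminus total_flux_def by simp
  have nz: "p y u * mean_flux y u ?f = 0" for y
  proof -
    have "- (case (y, u) of (x, y) \<Rightarrow> p x y * mean_flux x y ?f) = 0"
      by (rule nonneg_infsum_le_0D[where A = UNIV])
        (use tot integral_generator(2)[OF test] nonpos in \<open>auto intro!: summable_on_uminus[THEN iffD2]\<close>)
    then show ?thesis by simp
  qed
  show ?thesis
  proof (rule ccontr)
    assume "l y \<noteq> 0"
    then have "0 < l y" "y \<noteq> u" using l_nonneg[of y] zero by auto
    then show False using nz[of y] into[of y] empty_rate_pos[of y] edge by auto
  qed
qed

end

context misanthrope_product
begin

text \<open>
  At a site with \<open>l u = 0\<close> the balance equation is a vanishing sum of nonnegative terms.
\<close>

lemma balance_spreads_vacancy:
  assumes bal: "balance_equation p l" and zero: "l u = 0" and edge: "0 < p y u"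
  shows "l y = 0"
proof (cases "y = u")
  case False
  then have y: "y \<in> neighbours u" using edge kernel_nonneg[of u y] by (simp add: neighbours_def)
  have "(\<Sum>z\<in>neighbours u. l z * p z u) = (\<Sum>z\<in>neighbours u. net_flow u z)"
    by (simp add: net_flow_def zero)
  then have "(\<Sum>z\<in>neighbours u. l z * p z u) = 0"
    using bal by (simp add: balance_equation_iff)
  then have "l y * p y u = 0"
    using y finite_neighbours[of u] by (subst (asm) sum_nonneg_eq_0_iff) (auto intro: mult_nonneg_nonneg l_nonneg kernel_nonneg)
  then show ?thesis using edge by simp
qed (use zero in simp)

lemma vacant_everywhere:
  assumes spread: "\<And>u y. l u = 0 \<Longrightarrow> 0 < p y u \<Longrightarrow> l y = 0" and zero: "l u = 0"
  shows "l x = 0"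
  using irreducible[of x u]
  by (induction rule: converse_rtrancl_induct) (use zero spread in auto)

lemma invariant_if_balanced:
  assumes bal: "balance_equation p l" and type: "type_a N b \<or> type_b N b p l \<or> type_c p l"
  shows "\<mu> \<in> invariant_measures N b p"
  unfolding invariant_iff_total_flux
proof
  fix f :: "('s \<Rightarrow> nat) \<Rightarrow> real" assume f: "f \<in> test_functions N"
  show "total_flux f = 0"
  proof (cases "\<exists>u. l u = 0")
    case True
    then have "l x = 0" for x using vacant_everywhere balance_spreads_vacancy[OF bal] by blast
    then have "mean_flux x y f = 0" for x y
      using mean_flux_vacant[OF observable_test_function[OF f]] by blast
    then show ?thesis by (simp add: total_flux_def split_beta')
  next
    case False
    then have pos: "0 < l x" for x using l_nonneg[of x] by (metis less_le)
    show ?thesis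
      by (rule total_flux_local_dense[OF f]) (rule total_flux_eq_0[OF bal type pos])
  qed
qed


section \<open>Necessity\<close>

text \<open>
  The stationary equation for the indicator of \<open>\<eta> u = 0\<close>: an empty site sends out no particles,
  so only the bonds into \<open>u\<close> remain.
\<close>

lemma vacant_site_flux:
  assumes inv: "\<mu> \<in> invariant_measures N b p" and pos: "\<And>x. 0 < l x"
  shows "(\<Sum>y\<in>neighbours u. net_flow y u * (empty_rate y / l y)) = 0"
proof -
  let ?f = "\<lambda>\<eta>. if \<eta> u = 0 then 1 else (0::real)"
  have test: "?f \<in> test_functions N"
    using two_site_test_function[of "\<lambda>n k. if n = 0 then 1 else 0" 1 u u N] by simp
  have obs: "observable N ?f" by (rule observable_test_function[OF test])
  have dep: "depends_on N {u} ?f" by (simp add: depends_on_def)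
  have out: "rate_moment u y ?f = 0" for y
  proof -
    have "rate_moment u y ?f = (\<integral>\<eta>. 0 \<partial>\<mu>)"
      unfolding rate_moment_def
    proof (rule Bochner_Integration.integral_cong[OF refl])
      fix \<eta> assume "\<eta> \<in> space \<mu>"
      then have "\<eta> y \<in> occ N" by (simp add: space_product config_def)
      then show "b (\<eta> u) (\<eta> y) * ?f \<eta> = 0" using rate_eq_0_iff[OF zero_in_occ] by simp
    qed
    then show ?thesis by simp
  qed
  have into: "rate_moment y u ?f = site_prob u 0 * empty_rate y" if "y \<noteq> u" for y
  proof -
    have "rate_moment y u ?f = site_prob u 0 * (\<integral>\<eta>. b ((\<eta>(u := 0)) y) ((\<eta>(u := 0)) u) * ?f (\<eta>(u := 0)) \<partial>\<mu>)"
      unfolding rate_moment_def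
      by (rule resample_occupation[OF observable_mult[OF observable_rate obs] zero_in_occ]) simp
    then show ?thesis using that by (simp add: empty_rate_def)
  qed
  let ?h = "\<lambda>(x, y). net_flow x y / l x * rate_moment x y ?f"
  have "0 = total_flux ?f" using inv test by (simp add: invariant_iff_total_flux)
  also have "\<dots> = (\<Sum>z\<in>bonds {u}. ?h z)"
    by (rule total_flux_local[OF obs dep _ pos]) simp
  also have "\<dots> = (\<Sum>z\<in>neighbours u \<times> {u}. ?h z)"
  proof (rule sum.mono_neutral_right)
    show "neighbours u \<times> {u} \<subseteq> bonds {u}" using neighbours_sym by (auto simp: bonds_def)
    have "bonds {u} - neighbours u \<times> {u} \<subseteq> {u} \<times> UNIV" using neighbours_sym by (auto simp: bonds_def)
    then show "\<forall>z\<in>bonds {u} - neighbours u \<times> {u}. ?h z = 0" using out by auto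
  qed (simp add: finite_bonds)
  also have "\<dots> = (\<Sum>y\<in>neighbours u. \<Sum>x\<in>{u}. net_flow y x / l y * rate_moment y x ?f)"
    by (rule sum.cartesian_product[symmetric])
  also have "\<dots> = (\<Sum>y\<in>neighbours u. net_flow y u / l y * (site_prob u 0 * empty_rate y))"
    by (rule sum.cong[OF refl]) (use into in \<open>auto simp: neighbours_def\<close>)
  also have "\<dots> = site_prob u 0 * (\<Sum>y\<in>neighbours u. net_flow y u * (empty_rate y / l y))"
    by (simp add: sum_distrib_left mult_ac)
  finally show ?thesis using site_prob_pos[OF zero_in_occ pos, of u] by simp
qed

text \<open>
  The stationary equation for the indicator of \<open>\<eta> u = m \<and> \<eta> v = n\<close>, divided by the probability
  of this event. The bonds other than the one between \<open>u\<close> and \<open>v\<close> touch just one of these two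
  sites, hence contribute a function of \<open>m\<close> alone or of \<open>n\<close> alone.
\<close>

lemma two_site_separation:
  assumes inv: "\<mu> \<in> invariant_measures N b p" and pos: "\<And>x. 0 < l x" and uv: "u \<noteq> v"
  obtains H K where "\<And>m n. m \<in> occ N \<Longrightarrow> n \<in> occ N \<Longrightarrow>
    net_flow u v / l u * b m n + net_flow v u / l v * b n m = H m + K n"
proof -
  define A where "A = neighbours u - {v}"
  define C where "C = neighbours v - {u}"
  have fin: "finite A" "finite C" by (simp_all add: A_def C_def finite_neighbours)
  define G where "G w D m = (\<Sum>y\<in>D. net_flow w y / l w * (\<integral>\<eta>. b m (\<eta> y) \<partial>\<mu>)
    + net_flow y w / l y * (\<integral>\<eta>. b (\<eta> y) m \<partial>\<mu>))" for w D m
  have "net_flow u v / l u * b m n + net_flow v u / l v * b n m = - G u A m + - G v C n"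
    if m: "m \<in> occ N" and n: "n \<in> occ N" for m n
  proof -
    interpret Mu: prob_space \<mu> by (rule prob_space_product)
    let ?f = "\<lambda>\<eta>. if \<eta> u = m \<and> \<eta> v = n then 1 else (0::real)"
    let ?P = "site_prob u m * site_prob v n"
    have test: "?f \<in> test_functions N"
      by (rule two_site_test_function[of "\<lambda>i j. if i = m \<and> j = n then 1 else 0" 1 u v N]) simp
    have obs: "observable N ?f" by (rule observable_test_function[OF test])
    have dep: "depends_on N {u, v} ?f" by (simp add: depends_on_def)
    have fix_both: "rate_moment x y ?f = ?P * (\<integral>\<eta>. b ((\<eta>(v := n, u := m)) x) ((\<eta>(v := n, u := m)) y) \<partial>\<mu>)"
      for x y
    proof -
      let ?g = "\<lambda>\<eta>. b (\<eta> x) (\<eta> y) * ?f \<eta>"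
      have g: "observable N ?g" by (intro observable_mult observable_rate obs)
      have "rate_moment x y ?f = site_prob u m * (\<integral>\<eta>. ?g (\<eta>(u := m)) \<partial>\<mu>)"
        unfolding rate_moment_def by (rule resample_occupation[OF g m]) simp
      also have "(\<integral>\<eta>. ?g (\<eta>(u := m)) \<partial>\<mu>) = site_prob v n * (\<integral>\<eta>. ?g (\<eta>(v := n, u := m)) \<partial>\<mu>)"
        by (rule resample_occupation[OF observable_update[OF g m] n]) (use uv in simp)
      finally show ?thesis using uv by simp
    qed
    let ?h = "\<lambda>(x, y). net_flow x y / l x * rate_moment x y ?f"
    let ?k = "\<lambda>x y. net_flow x y / l x * rate_moment x y ?f"
    \<comment> \<open>The two orientations of the bond \<open>u, v\<close> are included in \<open>?S\<close> even if \<open>u\<close> and \<open>v\<close> are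
      not neighbours; the flow between them is then zero.\<close>
    let ?S = "{(u, v), (v, u)} \<union> ({u} \<times> A \<union> A \<times> {u} \<union> ({v} \<times> C \<union> C \<times> {v}))"
    have "0 = total_flux ?f" using inv test by (simp add: invariant_iff_total_flux)
    also have "\<dots> = (\<Sum>z\<in>bonds {u, v}. ?h z)"
      by (rule total_flux_local[OF obs dep _ pos]) simp
    also have "\<dots> = (\<Sum>z\<in>?S. ?h z)"
    proof (rule sum.mono_neutral_left)
      show "bonds {u, v} \<subseteq> ?S"
        using neighbours_sym by (auto simp: A_def C_def bonds_def)
      have "?h (u, v) = 0" if "(u, v) \<notin> bonds {u, v}"
        using that net_flow_off_neighbours[of v u] by (simp add: bonds_def)
      moreover have "?h (v, u) = 0" if "(v, u) \<notin> bonds {u, v}"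
        using that net_flow_off_neighbours[of u v] by (simp add: bonds_def)
      moreover have "?S - bonds {u, v} \<subseteq> {(u, v), (v, u)}"
        using neighbours_sym by (auto simp: A_def C_def bonds_def)
      ultimately show "\<forall>z\<in>?S - bonds {u, v}. ?h z = 0" by blast
    qed (use fin in simp)
    also have "\<dots> = (\<Sum>z\<in>{(u, v), (v, u)}. ?h z) + ((\<Sum>z\<in>{u} \<times> A. ?h z) + (\<Sum>z\<in>A \<times> {u}. ?h z)
        + ((\<Sum>z\<in>{v} \<times> C. ?h z) + (\<Sum>z\<in>C \<times> {v}. ?h z)))"
      using fin uv
      by (subst sum.union_disjoint, simp, simp, force simp: A_def C_def neighbours_def)+ (rule refl)
    also have "(\<Sum>z\<in>{(u, v), (v, u)}. ?h z) = ?P * (net_flow u v / l u * b m n + net_flow v u / l v * b n m)"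
      using uv by (simp add: fix_both Mu.prob_space algebra_simps)
    also have "(\<Sum>z\<in>{u} \<times> A. ?h z) + (\<Sum>z\<in>A \<times> {u}. ?h z) = ?P * G u A m"
    proof -
      have "(\<Sum>z\<in>{u} \<times> A. ?h z) + (\<Sum>z\<in>A \<times> {u}. ?h z) = (\<Sum>y\<in>A. ?k u y + ?k y u)"
        unfolding sum.cartesian_product[of ?k, symmetric] by (simp add: sum.distrib)
      also have "\<dots> = (\<Sum>y\<in>A. ?P * (net_flow u y / l u * (\<integral>\<eta>. b m (\<eta> y) \<partial>\<mu>)
          + net_flow y u / l y * (\<integral>\<eta>. b (\<eta> y) m \<partial>\<mu>)))"
        by (rule sum.cong[OF refl])
          (use uv in \<open>auto simp: fix_both A_def neighbours_def algebra_simps\<close>)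
      finally show ?thesis by (simp add: G_def sum_distrib_left)
    qed
    also have "(\<Sum>z\<in>{v} \<times> C. ?h z) + (\<Sum>z\<in>C \<times> {v}. ?h z) = ?P * G v C n"
    proof -
      have "(\<Sum>z\<in>{v} \<times> C. ?h z) + (\<Sum>z\<in>C \<times> {v}. ?h z) = (\<Sum>y\<in>C. ?k v y + ?k y v)"
        unfolding sum.cartesian_product[of ?k, symmetric] by (simp add: sum.distrib)
      also have "\<dots> = (\<Sum>y\<in>C. ?P * (net_flow v y / l v * (\<integral>\<eta>. b n (\<eta> y) \<partial>\<mu>)
          + net_flow y v / l y * (\<integral>\<eta>. b (\<eta> y) n \<partial>\<mu>)))"
        by (rule sum.cong[OF refl])
          (use uv in \<open>auto simp: fix_both C_def neighbours_def algebra_simps\<close>)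
      finally show ?thesis by (simp add: G_def sum_distrib_left)
    qed
    finally have "?P * (net_flow u v / l u * b m n + net_flow v u / l v * b n m + (G u A m + G v C n)) = 0"
      by (simp only: distrib_left)
    moreover have "?P \<noteq> 0"
      using site_prob_pos[OF m pos, of u] site_prob_pos[OF n pos, of v] by simp
    ultimately have "net_flow u v / l u * b m n + net_flow v u / l v * b n m + (G u A m + G v C n) = 0"
      by (simp only: mult_eq_0_iff simp_thms)
    then show ?thesis by linarith
  qed
  then show thesis by (rule that)
qed

text \<open>
  The mixed second difference annihilates a function of \<open>m\<close> plus a function of \<open>n\<close>; it is taken
  with respect to \<open>0\<close>, where \<open>b 0 k = 0\<close>.
\<close>

lemma net_flow_constraint:
  assumes inv: "\<mu> \<in> invariant_measures N b p" and pos: "\<And>x. 0 < l x" and flow: "net_flow u v \<noteq> 0"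
    and m: "m \<in> occ N" and n: "n \<in> occ N"
  shows "l v * (b m n - b m 0) = l u * (b n m - b n 0)"
proof -
  have uv: "u \<noteq> v" using flow by (auto simp: net_flow_def)
  obtain H K where HK: "\<And>m n. m \<in> occ N \<Longrightarrow> n \<in> occ N \<Longrightarrow>
    net_flow u v / l u * b m n + net_flow v u / l v * b n m = H m + K n"
    using two_site_separation[OF inv pos uv] by blast
  have zero: "b 0 k = 0" if "k \<in> occ N" for k using rate_eq_0_iff[OF zero_in_occ that] by simp
  let ?c = "b m n - b m 0" and ?d = "b n m - b n 0"
  have "net_flow u v / l u * ?c + net_flow v u / l v * ?d = 0"
    using HK[OF m n] HK[OF m zero_in_occ] HK[OF zero_in_occ n] HK[OF zero_in_occ zero_in_occ]
    by (simp add: zero m n zero_in_occ right_diff_distrib)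
  moreover have "net_flow u v * (?c / l u - ?d / l v) = net_flow u v / l u * ?c + net_flow v u / l v * ?d"
    unfolding net_flow_antisym[of v u] by (simp add: right_diff_distrib diff_divide_distrib)
  ultimately have "net_flow u v * (?c / l u - ?d / l v) = 0" by simp
  then have "?c / l u = ?d / l v" using flow by simp
  then show ?thesis using pos[of u] pos[of v] by (simp add: field_simps)
qed

text \<open>
  Applying the constraint to \<open>(m, n)\<close> and to \<open>(n, m)\<close> multiplies \<open>b m n - b m 0\<close> by
  \<open>(l u / l v)\<^sup>2\<close>. So either \<open>l u = l v\<close> or all these differences vanish.
\<close>

lemma invariant_type:
  assumes inv: "\<mu> \<in> invariant_measures N b p" and pos: "\<And>x. 0 < l x"
  shows "type_a N b \<or> type_b N b p l \<or> type_c p l"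
proof (cases "type_a N b \<or> type_c p l")
  case False
  let ?c = "\<lambda>m n. b m n - b m 0"
  have eq: "l u = l v" if flow: "net_flow u v \<noteq> 0" for u v
  proof (rule ccontr)
    assume ne: "l u \<noteq> l v"
    have "?c m n = 0" if "m \<in> occ N" "n \<in> occ N" for m n
    proof -
      have 1: "l v * ?c m n = l u * ?c n m" and 2: "l v * ?c n m = l u * ?c m n"
        using net_flow_constraint[OF inv pos flow] that by blast+
      have "(l v * l v) * ?c m n = l u * (l v * ?c n m)" using 1 by (simp add: mult.assoc mult.left_commute)
      then have "(l v * l v - l u * l u) * ?c m n = 0" unfolding 2 by (simp add: algebra_simps)
      moreover have "l v * l v - l u * l u \<noteq> 0"
        using ne pos[of u] pos[of v] by (metis less_imp_le right_minus_eq abs_of_nonneg real_sqrt_abs2)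
      ultimately show ?thesis by simp
    qed
    then have "type_a N b" by (simp add: type_a_def)
    with False show False by simp
  qed
  obtain u v where flow: "net_flow u v \<noteq> 0"
    using False by (auto simp: type_c_def net_flow_def)
  have "b n k - b k n = b n 0 - b k 0" if "n \<in> occ N" "k \<in> occ N" for n k
    using net_flow_constraint[OF inv pos flow that] eq[OF flow] pos[of v] by simp
  moreover have "l x = l y" if "l x * p x y \<noteq> l y * p y x" for x y
    using eq[of x y] that by (simp add: net_flow_def)
  ultimately show ?thesis by (simp add: type_b_def)
qed blast

lemma rate_moment_one: "l y * rate_moment x y (\<lambda>_. 1) = l x * rate_moment y x (\<lambda>_. 1)" if "x \<noteq> y"
  using jump_exchange[OF observable_const that, of 1] by (simp add: rate_moment_def)

text \<open>
  The exchange identity for the constant function \<open>1\<close> compares the mean rates of the two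
  orientations of a bond. Under (a) these are the empty rates themselves, and under (b), where
  \<open>l x = l y\<close>, they are equal, while their difference is that of the empty rates.
\<close>

lemma empty_rate_ratio:
  assumes type: "type_a N b \<or> type_b N b p l \<or> type_c p l" and pos: "\<And>x. 0 < l x" and flow: "net_flow x y \<noteq> 0"
  shows "empty_rate x / l x = empty_rate y / l y"
proof -
  have xy: "x \<noteq> y" using flow by (auto simp: net_flow_def)
  from type show ?thesis
  proof (elim disjE)
    assume "type_a N b"
    then have "l y * empty_rate x = l x * empty_rate y"
      using rate_moment_one[OF xy] by (simp add: type_a_moment empty_rate_def)
    then show ?thesis using pos[of x] pos[of y] by (simp add: field_simps)
  next
    assume tb: "type_b N b p l"
    then have "l x = l y" using flow by (auto simp: type_b_def net_flow_def)
    moreover from this have "rate_moment x y (\<lambda>_. 1) = rate_moment y x (\<lambda>_. 1)"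
      using rate_moment_one[OF xy] pos[of x] by simp
    then have "empty_rate x = empty_rate y"
      using type_b_moment[OF tb observable_const, of x y 1] by (simp add: empty_rate_def)
    ultimately show ?thesis by simp
  next
    assume "type_c p l"
    then have "net_flow x y = 0" unfolding type_c_def net_flow_def by (metis diff_self)
    with flow show ?thesis by simp
  qed
qed

text \<open>
  The ratio of \<open>empty_rate y\<close> and \<open>l y\<close> is constant along bonds with flow, so that it can be taken out of
  the equation for the indicator of \<open>\<eta> u = 0\<close>.
\<close>

lemma invariant_balance:
  assumes inv: "\<mu> \<in> invariant_measures N b p" and pos: "\<And>x. 0 < l x"
  shows "balance_equation p l"
  unfolding balance_equation_iff
proof
  fix u
  have "0 = (\<Sum>y\<in>neighbours u. net_flow y u * (empty_rate y / l y))"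
    using vacant_site_flux[OF inv pos] by simp
  also have "\<dots> = (\<Sum>y\<in>neighbours u. net_flow u y * (- (empty_rate u / l u)))"
  proof (rule sum.cong[OF refl])
    fix y
    show "net_flow y u * (empty_rate y / l y) = net_flow u y * (- (empty_rate u / l u))"
      using empty_rate_ratio[OF invariant_type[OF inv pos] pos, of y u] net_flow_antisym[of u y]
      by (cases "net_flow y u = 0") simp_all
  qed
  also have "\<dots> = (\<Sum>y\<in>neighbours u. net_flow u y) * (- (empty_rate u / l u))"
    by (rule sum_distrib_right[symmetric])
  finally show "(\<Sum>y\<in>neighbours u. net_flow u y) = 0"
    using empty_rate_pos[OF pos, of u] pos[of u] by simp
qed

lemma invariant_imp_balanced_type:
  assumes inv: "\<mu> \<in> invariant_measures N b p"
  shows "balance_equation p l \<and> (type_a N b \<or> type_b N b p l \<or> type_c p l)"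
proof (cases "\<exists>u. l u = 0")
  case True
  then have "l x = 0" for x using vacant_everywhere vacancy_spreads[OF inv] by blast
  then show ?thesis by (simp add: balance_equation_def type_c_def)
next
  case False
  then have pos: "0 < l x" for x using l_nonneg[of x] by (metis less_le)
  show ?thesis using invariant_balance[OF inv pos] invariant_type[OF inv pos] by simp
qed

end

theorem proposition1p15:
  fixes N :: enat
    and b :: "nat \<Rightarrow> nat \<Rightarrow> real"
    and p :: "'s::countable \<Rightarrow> 's \<Rightarrow> real"
  assumes "infinite (UNIV :: 's set)"
    and "standing_assumptions N b p"
  shows "(\<forall>l\<in>parameters N b. balance_equation p l \<longrightarrow>
            (type_a N b \<longrightarrow> product_measure N b l \<in> invariant_measures N b p) \<and>
            (type_b N b p l \<longrightarrow> product_measure N b l \<in> invariant_measures N b p) \<and>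
            (type_c p l \<longrightarrow> product_measure N b l \<in> invariant_measures N b p)) \<and>
         (\<forall>l\<in>parameters N b.
            product_measure N b l \<in> product_measures N b \<inter> invariant_measures N b p \<longrightarrow>
            balance_equation p l \<and> (type_a N b \<or> type_b N b p l \<or> type_c p l))"
proof -
  have "misanthrope_product N b p l" if "l \<in> parameters N b" for l
    using assms(2) that by unfold_locales
  then show ?thesis
    using misanthrope_product.invariant_if_balanced misanthrope_product.invariant_imp_balanced_type by blast
qed

end
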